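(* Let $\mathcal{L}:J^1(\mathbb{R},Q)=\mathbb{R}\times TQ\to\mathbb{R}$ be a Lagrangian which is a $C^2$ function with respect to $t,q,v$, whose first order derivatives are Lipschitz functions with respect to $t,q,v$, and which is hyperregular, meaning $\det\Big(\frac{\partial^2\mathcal{L}}{\partial v^i\partial v^j}\Big)\neq0$. Let $\gamma_1,\gamma_2:Q\to\mathbb{R}$ be of class $C^2$ with Lipschitz first order derivatives. Then the generalized fractional hybrid HP (Hamilton–Pontryagin) equations $$\begin{aligned} dq^i&=v^i\,ds,\\ dp_i&=\Big(\frac{\partial\mathcal{L}}{\partial q^i}-p_i\,h(s,t)\Big)ds+\frac{\partial\gamma_1(q)}{\partial q^i}\,dW(s)+\frac{\partial\gamma_2(q)}{\partial q^i}\,dL(s),\\ p_i&=\frac{\partial\mathcal{L}}{\partial v^i},\qquad i=1,\dots,n,\quad t\neq s,\end{aligned}$$ are equivalent to the equations (generalized fractional hybrid Hamiltonian equations) $$\begin{aligned} dq^i&=\frac{\partial H}{\partial p_i}\,ds,\\ dp_i&=\Big(-\frac{\partial H}{\partial q^i}-p_i\,h(s,t)\Big)ds+\frac{\partial\gamma_1(q)}{\partial q^i}\,dW(s)+\frac{\partial\gamma_2(q)}{\partial q^i}\,dL(s),\end{aligned}$$ where $$H=p_iv^i-\mathcal{L}(t,q,v),$$ $$h(s,t)=\frac{d\,\alpha(s-t)}{ds}\ln|t-s|+\frac{\alpha(s-t)-1}{s-t}+\rho-\frac{1}{\Gamma_1(\alpha(s-t))}\frac{d\,\Gamma_1(\a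lpha(s-t))}{ds}.$$
   Context: $Q$ is a paracompact $n$-dimensional configuration manifold with local coordinates $q^i$; $(q^i,v^i)$ and $(q^i,p_i)$ are the induced coordinates on $TQ$ and $T^*Q$; repeated indices are summed. In $H$, $v$ is expressed through $(q,p)$ by the relation $p_i=\partial\mathcal{L}/\partial v^i$. $t\in\mathbb{R}$ is the "observed time" and $s\neq t$ the "intrinsic time", which is the running variable. $\alpha:\mathbb{R}\to\mathbb{R}$ is a $C^1$ function, $\rho>0$ is a real constant, $\Gamma$ is the Euler Gamma function and $\Gamma_1(\alpha(s-t))=\Gamma(\alpha(z))|_{z=s-t}$. $W$ is a real-valued Wiener process on a probability space $(\Omega,\mathcal{F},P_r)$. A credibility space is a triple $(\Theta,\mathcal{P},C_r)$, where $\mathcal{P}$ is the power set of the nonempty set $\Theta$ and $C_r:\mathcal{P}\to[0,1]$ satisfies $C_r(\Theta)=1$, monotonicity, $C_r(A)+C_r(A^c)=1$, and $C_r(\bigcup_iA_i)=\sup_iC_r(A_i)$ whenever $\sup_iC_r(A_i)<1/2$; functions on $\Theta$ are called fuzzy variables. $L$ is a real-valued Liu process on the credibility space: $L(0)=0$, $L$ has stationary and independent increments, and each increment $L(s+r)-L(s)$ is a normally distributed fuzzy variable, with membership function $\mu(x)=2\left(1+\exp\left(\frac{\pi|x-er|}{\sqrt6\,\sigma r}\right)\right)^{-1}$ (constants $e\in\mathbb{R}$, $\sigma>0$). Unknown processes are functions of $(s,\theta,\omega)$ on the chance space $(\Theta,\mathcal{P},C_r)\times(\Omega,\mathcal{F},P_r)$.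 Integrals $dW$ are Itô integrals; integrals $\int X\,dL$ are Liu integrals, i.e. limits of $\sum_kX(s_k)(L(s_{k+1})-L(s_k))$ as the mesh tends to $0$. Differential equations are formal notation for the corresponding integral equations over $s$. *)

theory Defs
  imports "HOL-Probability.Probability"
begin

text \<open>Only used on open sets \<open>S\<close>.\<close>

primrec Ck_on :: "nat \<Rightarrow> ('a::euclidean_space \<Rightarrow> 'b::real_normed_vector) \<Rightarrow> 'a set \<Rightarrow> bool" where
  "Ck_on 0 f S = continuous_on S f"
| "Ck_on (Suc k) f S =
     (f differentiable_on S \<and> (\<forall>b\<in>Basis. Ck_on k (\<lambda>x. frechet_derivative f (at x) b) S))"

definition C2_Lipschitz_on :: "('a::euclidean_space \<Rightarrow> real) \<Rightarrow> 'a set \<Rightarrow> bool" where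
  "C2_Lipschitz_on f S \<longleftrightarrow> Ck_on 2 f S \<and>
     (\<forall>b\<in>Basis. \<exists>K. K-lipschitz_on S (\<lambda>x. frechet_derivative f (at x) b))"

definition partial :: "'n::finite \<Rightarrow> (real^'n \<Rightarrow> real) \<Rightarrow> real^'n \<Rightarrow> real" where
  "partial i f x = deriv (\<lambda>r. f (x + r *\<^sub>R axis i 1)) 0"

definition paracompact :: "'q::topological_space itself \<Rightarrow> bool" where
  "paracompact _ \<longleftrightarrow> (\<forall>\<U>::'q set set. (\<forall>U\<in>\<U>. open U) \<and> \<Union>\<U> = UNIV \<longrightarrow>
     (\<exists>\<V>. (\<forall>V\<in>\<V>. open V \<and> (\<exists>U\<in>\<U>. V \<subseteq> U)) \<and> \<Union>\<V> = UNIV \<and>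
        locally_finite_in euclidean \<V>))"

type_synonym ('q, 'n) chart = "'q set \<times> ('q \<Rightarrow> real^'n)"

abbreviation chart_dom :: "('q, 'n) chart \<Rightarrow> 'q set" where
  "chart_dom c \<equiv> fst c"

abbreviation chart_coord :: "('q, 'n) chart \<Rightarrow> 'q \<Rightarrow> real^'n" where
  "chart_coord c \<equiv> snd c"

abbreviation chart_image :: "('q, 'n) chart \<Rightarrow> (real^'n) set" where
  "chart_image c \<equiv> chart_coord c ` chart_dom c"

abbreviation chart_inv :: "('q, 'n) chart \<Rightarrow> real^'n \<Rightarrow> 'q" where
  "chart_inv c \<equiv> inv_into (chart_dom c) (chart_coord c)"

definition smooth_atlas :: "('q::t2_space, 'n::finite) chart set \<Rightarrow> bool" where
  "smooth_atlas A \<longleftrightarrow> (\<Union>c\<in>A. chart_dom c) = UNIV \<and>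
     (\<forall>c\<in>A. open (chart_dom c) \<and> open (chart_image c) \<and>
        homeomorphism (chart_dom c) (chart_image c) (chart_coord c) (chart_inv c)) \<and>
     (\<forall>c\<in>A. \<forall>d\<in>A. \<forall>k.
        Ck_on k (chart_coord d \<circ> chart_inv c) (chart_coord c ` (chart_dom c \<inter> chart_dom d)))"

definition transition_deriv ::
    "('q, 'n::finite) chart \<Rightarrow> ('q, 'n) chart \<Rightarrow> 'q \<Rightarrow> real^'n \<Rightarrow> real^'n" where
  "transition_deriv c d m =
     frechet_derivative (chart_coord d \<circ> chart_inv c) (at (chart_coord c m))"

text \<open>
  A tangent vector or covector at \<open>m\<close> is given by its components in all the charts of the
  atlas around \<open>m\<close>, subject to the transformation law; the value at any other argument is
  fixed to be \<open>0\<close>.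
\<close>

type_synonym ('q, 'n) bundle_point = "'q \<times> (('q, 'n) chart \<Rightarrow> real^'n)"

definition tangent_bundle :: "('q, 'n::finite) chart set \<Rightarrow> ('q, 'n) bundle_point set" where
  "tangent_bundle A = {(m, X).
     (\<forall>c\<in>A. \<forall>d\<in>A. m \<in> chart_dom c \<inter> chart_dom d \<longrightarrow> X d = transition_deriv c d m (X c)) \<and>
     (\<forall>c. \<not> (c \<in> A \<and> m \<in> chart_dom c) \<longrightarrow> X c = 0)}"

definition cotangent_bundle :: "('q, 'n::finite) chart set \<Rightarrow> ('q, 'n) bundle_point set" where
  "cotangent_bundle A = {(m, P).
     (\<forall>c\<in>A. \<forall>d\<in>A. m \<in> chart_dom c \<inter> chart_dom d \<longrightarrow>
        (\<forall>w. P c \<bullet> w = P d \<bullet> transition_deriv c d m w)) \<and>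
     (\<forall>c. \<not> (c \<in> A \<and> m \<in> chart_dom c) \<longrightarrow> P c = 0)}"

text \<open>The points of the two bundles with coordinates \<open>(x, v)\<close>, resp. \<open>(x, p)\<close>, in the chart \<open>c\<close>.\<close>

definition tangent_point ::
    "('q, 'n::finite) chart set \<Rightarrow> ('q, 'n) chart \<Rightarrow> real^'n \<Rightarrow> real^'n \<Rightarrow> ('q, 'n) bundle_point" where
  "tangent_point A c x v = (let m = chart_inv c x in
     (m, \<lambda>d. if d \<in> A \<and> m \<in> chart_dom d then transition_deriv c d m v else 0))"

definition cotangent_point ::
    "('q, 'n::finite) chart set \<Rightarrow> ('q, 'n) chart \<Rightarrow> real^'n \<Rightarrow> real^'n \<Rightarrow> ('q, 'n) bundle_point" where
  "cotangent_point A c x p = (let m = chart_inv c x in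
     (m, \<lambda>d. if d \<in> A \<and> m \<in> chart_dom d
             then (\<chi> i. p \<bullet> transition_deriv d c m (axis i 1)) else 0))"

type_synonym ('q, 'n) lagrangian = "real \<times> ('q, 'n) bundle_point \<Rightarrow> real"

definition lagr ::
    "('q, 'n::finite) chart set \<Rightarrow> ('q, 'n) lagrangian \<Rightarrow> ('q, 'n) chart \<Rightarrow>
     real \<Rightarrow> real^'n \<Rightarrow> real^'n \<Rightarrow> real" where
  "lagr A \<L> c t x v = \<L> (t, tangent_point A c x v)"

definition regular_lagrangian :: "('q, 'n::finite) chart set \<Rightarrow> ('q, 'n) lagrangian \<Rightarrow> bool" where
  "regular_lagrangian A \<L> \<longleftrightarrow>
     (\<forall>c\<in>A. C2_Lipschitz_on (\<lambda>(t, x, v). lagr A \<L> c t x v) (UNIV \<times> chart_image c \<times> UNIV))"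

definition hyperregular :: "('q, 'n::finite) chart set \<Rightarrow> ('q, 'n) lagrangian \<Rightarrow> bool" where
  "hyperregular A \<L> \<longleftrightarrow> (\<forall>c\<in>A. \<forall>t. \<forall>x\<in>chart_image c. \<forall>v.
     det (\<chi> i j. partial i (partial j (lagr A \<L> c t x)) v) \<noteq> 0)"

definition regular_potential :: "('q, 'n::finite) chart set \<Rightarrow> ('q \<Rightarrow> real) \<Rightarrow> bool" where
  "regular_potential A \<gamma> \<longleftrightarrow> (\<forall>c\<in>A. C2_Lipschitz_on (\<gamma> \<circ> chart_inv c) (chart_image c))"

text \<open>The fibre derivative \<open>p\<^sub>i = \<partial>\<L>/\<partial>v\<^sup>i\<close> at the fixed observed time \<open>t\<close>.\<close>

definition legendre ::
    "('q, 'n::finite) chart set \<Rightarrow> ('q, 'n) lagrangian \<Rightarrow> real \<Rightarrow>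
     ('q, 'n) bundle_point \<Rightarrow> ('q, 'n) bundle_point" where
  "legendre A \<L> t = (\<lambda>(m, X). (m, \<lambda>c. if c \<in> A \<and> m \<in> chart_dom c
     then (\<chi> i. partial i (lagr A \<L> c t (chart_coord c m)) (X c)) else 0))"

text \<open>
  A non-vanishing Hessian determinant makes the fibre derivative a local, but in general not a
  global, diffeomorphism.  Hence \<open>v\<close> is a function of \<open>(q, p)\<close> once velocities are confined to an
  open subset \<open>D\<close> of the tangent bundle on which the fibre derivative is injective (the whole
  bundle, if it is injective there).
\<close>

definition legendre_domain ::
    "('q, 'n::finite) chart set \<Rightarrow> ('q, 'n) lagrangian \<Rightarrow> real \<Rightarrow> ('q, 'n) bundle_point set \<Rightarrow> bool" where
  "legendre_domain A \<L> t D \<longleftrightarrow> D \<subseteq> tangent_bundle A \<and>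
     (\<forall>c\<in>A. open {(x, v). x \<in> chart_image c \<and> tangent_point A c x v \<in> D}) \<and>
     inj_on (legendre A \<L> t) D"

abbreviation legendre_inv ::
    "('q, 'n::finite) chart set \<Rightarrow> ('q, 'n) lagrangian \<Rightarrow> real \<Rightarrow> ('q, 'n) bundle_point set \<Rightarrow>
     ('q, 'n) bundle_point \<Rightarrow> ('q, 'n) bundle_point" where
  "legendre_inv A \<L> t D \<equiv> inv_into D (legendre A \<L> t)"

definition hamiltonian ::
    "('q, 'n::finite) chart set \<Rightarrow> ('q, 'n) lagrangian \<Rightarrow> real \<Rightarrow> ('q, 'n) bundle_point set \<Rightarrow>
     ('q, 'n) chart \<Rightarrow> real^'n \<Rightarrow> real^'n \<Rightarrow> real" where
  "hamiltonian A \<L> t D c x p =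
     (let v = snd (legendre_inv A \<L> t D (cotangent_point A c x p)) c
      in (\<Sum>i\<in>UNIV. p $ i * v $ i) - lagr A \<L> c t x v)"

definition credibility :: "('\<theta> set \<Rightarrow> real) \<Rightarrow> bool" where
  "credibility Cr \<longleftrightarrow> (\<forall>B. Cr B \<in> {0..1}) \<and> Cr UNIV = 1 \<and>
     (\<forall>B B'. B \<subseteq> B' \<longrightarrow> Cr B \<le> Cr B') \<and>
     (\<forall>B. Cr B + Cr (- B) = 1) \<and>
     (\<forall>\<B>. \<B> \<noteq> {} \<and> (SUP B\<in>\<B>. Cr B) < 1/2 \<longrightarrow> Cr (\<Union>\<B>) = (SUP B\<in>\<B>. Cr B))"

definition membership :: "('\<theta> set \<Rightarrow> real) \<Rightarrow> ('\<theta> \<Rightarrow> real) \<Rightarrow> real \<Rightarrow> real" where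
  "membership Cr \<xi> x = min 1 (2 * Cr {\<theta>. \<xi> \<theta> = x})"

text \<open>
  Independence of fuzzy variables is the min-rule for arbitrary sets of values, and identical
  distribution is equality of the credibilities of all sets of values.
\<close>

definition liu_process ::
    "('\<theta> set \<Rightarrow> real) \<Rightarrow> real \<Rightarrow> real \<Rightarrow> (real \<Rightarrow> '\<theta> \<Rightarrow> real) \<Rightarrow> bool" where
  "liu_process Cr e \<sigma> L \<longleftrightarrow>
     (\<forall>\<theta>. L 0 \<theta> = 0) \<and>
     (\<forall>r>0. \<forall>s\<ge>0. \<forall>s'\<ge>0. \<forall>B.
        Cr {\<theta>. L (s + r) \<theta> - L s \<theta> \<in> B} = Cr {\<theta>. L (s' + r) \<theta> - L s' \<theta> \<in> B}) \<and>
     (\<forall>m>0. \<forall>\<tau>. 0 \<le> \<tau> 0 \<and> (\<forall>k<m. \<tau> k < \<tau> (Suc k)) \<longrightarrow>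
        (\<forall>B. Cr {\<theta>. \<forall>k<m. L (\<tau> (Suc k)) \<theta> - L (\<tau> k) \<theta> \<in> B k} =
           Min ((\<lambda>k. Cr {\<theta>. L (\<tau> (Suc k)) \<theta> - L (\<tau> k) \<theta> \<in> B k}) ` {..<m::nat}))) \<and>
     (\<forall>s\<ge>0. \<forall>r>0. \<forall>x. membership Cr (\<lambda>\<theta>. L (s + r) \<theta> - L s \<theta>) x =
        2 / (1 + exp (pi * \<bar>x - e * r\<bar> / (sqrt 6 * \<sigma> * r))))"

definition wiener_process ::
    "'\<omega> measure \<Rightarrow> (real \<Rightarrow> '\<omega> measure) \<Rightarrow> (real \<Rightarrow> '\<omega> \<Rightarrow> real) \<Rightarrow> bool" where
  "wiener_process M F W \<longleftrightarrow>
     prob_space M \<and> filtration (space M) F \<and> (\<forall>s. sets (F s) \<subseteq> sets M) \<and>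
     (\<forall>s\<ge>0. W s \<in> borel_measurable (F s)) \<and>
     (AE \<omega> in M. W 0 \<omega> = 0) \<and>
     (AE \<omega> in M. continuous_on {0..} (\<lambda>s. W s \<omega>)) \<and>
     (\<forall>s\<ge>0. \<forall>u>s.
        distributed M lborel (\<lambda>\<omega>. W u \<omega> - W s \<omega>) (normal_density 0 (sqrt (u - s))) \<and>
        prob_space.indep_set M (sets (F s))
          {(\<lambda>\<omega>. W u \<omega> - W s \<omega>) -` B \<inter> space M | B. B \<in> sets borel})"

definition partition :: "real \<Rightarrow> real \<Rightarrow> nat \<Rightarrow> (nat \<Rightarrow> real) \<Rightarrow> bool" where
  "partition a b m \<tau> \<longleftrightarrow> \<tau> 0 = a \<and> \<tau> m = b \<and> (\<forall>k<m. \<tau> k \<le> \<tau> (Suc k))"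

definition liu_integral :: "(real \<Rightarrow> real) \<Rightarrow> (real \<Rightarrow> real) \<Rightarrow> real \<Rightarrow> real \<Rightarrow> real \<Rightarrow> bool" where
  "liu_integral l x a b J \<longleftrightarrow> (\<forall>\<epsilon>>0. \<exists>\<delta>>0. \<forall>m \<tau>.
     partition a b m \<tau> \<and> (\<forall>k<m. \<tau> (Suc k) - \<tau> k < \<delta>) \<longrightarrow>
     \<bar>(\<Sum>k<m. x (\<tau> k) * (l (\<tau> (Suc k)) - l (\<tau> k))) - J\<bar> < \<epsilon>)"

text \<open>
  \<open>Y\<close> has the Ito integral \<open>I\<close> over \<open>[a, b]\<close> on the event \<open>E\<close>: elementary nonanticipating
  integrands approximate \<open>Y\<close> in \<open>L\<^sup>2[a, b]\<close>, and their integrals approximate \<open>I\<close>.  Almost sure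
  convergence loses nothing against convergence in probability, as one may pass to a subsequence.
  For \<open>E = space M\<close> this is the usual integral; the localisation to \<open>E\<close> is needed because
  coordinate expressions make sense only as long as the path stays in the chart.
\<close>

definition ito_integral_on ::
    "'\<omega> measure \<Rightarrow> (real \<Rightarrow> '\<omega> measure) \<Rightarrow> (real \<Rightarrow> '\<omega> \<Rightarrow> real) \<Rightarrow> '\<omega> set \<Rightarrow>
     (real \<Rightarrow> '\<omega> \<Rightarrow> real) \<Rightarrow> real \<Rightarrow> real \<Rightarrow> ('\<omega> \<Rightarrow> real) \<Rightarrow> bool" where
  "ito_integral_on M F W E Y a b I \<longleftrightarrow>
     (\<exists>(m :: nat \<Rightarrow> nat) (\<tau> :: nat \<Rightarrow> nat \<Rightarrow> real) (\<xi> :: nat \<Rightarrow> nat \<Rightarrow> '\<omega> \<Rightarrow> real).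
        (\<forall>j. partition a b (m j) (\<tau> j) \<and>
           (\<forall>k<m j. \<xi> j k \<in> borel_measurable (F (\<tau> j k)) \<and>
              (\<exists>K. \<forall>\<omega>\<in>space M. \<bar>\<xi> j k \<omega>\<bar> \<le> K))) \<and>
        (AE \<omega> in M. \<omega> \<in> E \<longrightarrow>
           set_borel_measurable lborel {a..b} (\<lambda>s. Y s \<omega>) \<and>
           (\<lambda>j. \<integral>\<^sup>+s\<in>{a..b}. ennreal
              ((Y s \<omega> - (\<Sum>k<m j. \<xi> j k \<omega> * indicator {\<tau> j k<..\<tau> j (Suc k)} s))\<^sup>2) \<partial>lborel)
             \<longlonglongrightarrow> 0 \<and>
           (\<lambda>j. \<Sum>k<m j. \<xi> j k \<omega> * (W (\<tau> j (Suc k)) \<omega> - W (\<tau> j k) \<omega>)) \<longlonglongrightarrow> I \<omega>))"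

text \<open>
  Almost surely on the chance space.  For measurable events this says that the chance measure
  \<open>1 - sup\<^sub>\<theta> min (Cr {\<theta>}) (Pr (complement at \<theta>))\<close> equals \<open>1\<close>.
\<close>

definition chance_AE ::
    "('\<theta> set \<Rightarrow> real) \<Rightarrow> '\<omega> measure \<Rightarrow> ('\<theta> \<Rightarrow> '\<omega> \<Rightarrow> bool) \<Rightarrow> bool" where
  "chance_AE Cr M R \<longleftrightarrow> (\<forall>\<theta>. Cr {\<theta>} > 0 \<longrightarrow> (AE \<omega> in M. R \<theta> \<omega>))"

text \<open>\<open>dy = f ds + g dW + k dL\<close> between the times \<open>a\<close> and \<open>b\<close>, on the events \<open>E \<theta>\<close>.\<close>

definition hybrid_equation_on ::
    "('\<theta> set \<Rightarrow> real) \<Rightarrow> (real \<Rightarrow> '\<theta> \<Rightarrow> real) \<Rightarrow>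
     '\<omega> measure \<Rightarrow> (real \<Rightarrow> '\<omega> measure) \<Rightarrow> (real \<Rightarrow> '\<omega> \<Rightarrow> real) \<Rightarrow> ('\<theta> \<Rightarrow> '\<omega> set) \<Rightarrow>
     (real \<Rightarrow> '\<theta> \<Rightarrow> '\<omega> \<Rightarrow> real) \<Rightarrow> (real \<Rightarrow> '\<theta> \<Rightarrow> '\<omega> \<Rightarrow> real) \<Rightarrow>
     (real \<Rightarrow> '\<theta> \<Rightarrow> '\<omega> \<Rightarrow> real) \<Rightarrow> (real \<Rightarrow> '\<theta> \<Rightarrow> '\<omega> \<Rightarrow> real) \<Rightarrow> real \<Rightarrow> real \<Rightarrow> bool" where
  "hybrid_equation_on Cr L M F W E y f g k a b \<longleftrightarrow>
     (\<exists>I J.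
        (\<forall>\<theta>. Cr {\<theta>} > 0 \<longrightarrow> ito_integral_on M F W (E \<theta>) (\<lambda>s. g s \<theta>) a b (I \<theta>)) \<and>
        chance_AE Cr M (\<lambda>\<theta> \<omega>. \<omega> \<in> E \<theta> \<longrightarrow>
          liu_integral (\<lambda>s. L s \<theta>) (\<lambda>s. k s \<theta> \<omega>) a b (J \<theta> \<omega>) \<and>
          set_integrable lborel {a..b} (\<lambda>s. f s \<theta> \<omega>) \<and>
          y b \<theta> \<omega> - y a \<theta> \<omega> = (LBINT s:{a..b}. f s \<theta> \<omega>) + I \<theta> \<omega> + J \<theta> \<omega>))"

definition frac_coeff :: "(real \<Rightarrow> real) \<Rightarrow> real \<Rightarrow> real \<Rightarrow> real \<Rightarrow> real" where
  "frac_coeff \<alpha> \<rho> s t =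
     deriv (\<lambda>s. \<alpha> (s - t)) s * ln \<bar>t - s\<bar> + (\<alpha> (s - t) - 1) / (s - t) + \<rho>
     - 1 / Gamma (\<alpha> (s - t)) * deriv (\<lambda>s. Gamma (\<alpha> (s - t))) s"

text \<open>
  The system \<open>dq\<^sup>i = u\<^sup>i ds\<close>, \<open>dp\<^sub>i = f\<^sub>i ds + \<partial>\<gamma>\<^sub>1/\<partial>q\<^sup>i dW + \<partial>\<gamma>\<^sub>2/\<partial>q\<^sup>i dL\<close> for a process \<open>(q, p)\<close> in the
  cotangent bundle over the time interval \<open>S\<close>.  In each chart \<open>c\<close> and over each \<open>[a, b] \<subseteq> S\<close> the
  equations are imposed on those paths of \<open>q\<close> that stay in the domain of \<open>c\<close> during \<open>[a, b]\<close>; by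
  continuity of \<open>q\<close>, finitely many such pieces cover any compact part of a path.
\<close>

definition hybrid_system ::
    "('q::t2_space, 'n::finite) chart set \<Rightarrow> ('q \<Rightarrow> real) \<Rightarrow> ('q \<Rightarrow> real) \<Rightarrow>
     ('\<theta> set \<Rightarrow> real) \<Rightarrow> (real \<Rightarrow> '\<theta> \<Rightarrow> real) \<Rightarrow>
     '\<omega> measure \<Rightarrow> (real \<Rightarrow> '\<omega> measure) \<Rightarrow> (real \<Rightarrow> '\<omega> \<Rightarrow> real) \<Rightarrow> real set \<Rightarrow>
     (real \<Rightarrow> '\<theta> \<Rightarrow> '\<omega> \<Rightarrow> 'q) \<Rightarrow> (real \<Rightarrow> '\<theta> \<Rightarrow> '\<omega> \<Rightarrow> ('q, 'n) chart \<Rightarrow> real^'n) \<Rightarrow>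
     ('n \<Rightarrow> real \<Rightarrow> '\<theta> \<Rightarrow> '\<omega> \<Rightarrow> ('q, 'n) chart \<Rightarrow> real) \<Rightarrow>
     ('n \<Rightarrow> real \<Rightarrow> '\<theta> \<Rightarrow> '\<omega> \<Rightarrow> ('q, 'n) chart \<Rightarrow> real) \<Rightarrow> bool" where
  "hybrid_system A \<gamma>\<^sub>1 \<gamma>\<^sub>2 Cr L M F W S q p u f \<longleftrightarrow>
     (\<forall>\<theta>. Cr {\<theta>} > 0 \<longrightarrow> (\<forall>s\<in>S. q s \<theta> \<in> borel_measurable (F s) \<and>
        (\<forall>c\<in>A. (\<lambda>\<omega>. p s \<theta> \<omega> c) \<in> borel_measurable (F s)))) \<and>
     chance_AE Cr M (\<lambda>\<theta> \<omega>. continuous_on S (\<lambda>s. q s \<theta> \<omega>) \<and>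
        (\<forall>s\<in>S. (q s \<theta> \<omega>, p s \<theta> \<omega>) \<in> cotangent_bundle A)) \<and>
     (\<forall>c\<in>A. \<forall>a\<in>S. \<forall>b\<in>S. a \<le> b \<longrightarrow>
        (let E = (\<lambda>\<theta>. {\<omega>. \<forall>s\<in>{a..b}. q s \<theta> \<omega> \<in> chart_dom c});
             x = (\<lambda>s \<theta> \<omega>. chart_coord c (q s \<theta> \<omega>))
         in \<forall>i.
           chance_AE Cr M (\<lambda>\<theta> \<omega>. \<omega> \<in> E \<theta> \<longrightarrow>
             set_integrable lborel {a..b} (\<lambda>s. u i s \<theta> \<omega> c) \<and>
             x b \<theta> \<omega> $ i - x a \<theta> \<omega> $ i = (LBINT s:{a..b}. u i s \<theta> \<omega> c)) \<and>
           hybrid_equation_on Cr L M F W E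
             (\<lambda>s \<theta> \<omega>. p s \<theta> \<omega> c $ i)
             (\<lambda>s \<theta> \<omega>. f i s \<theta> \<omega> c)
             (\<lambda>s \<theta> \<omega>. partial i (\<gamma>\<^sub>1 \<circ> chart_inv c) (x s \<theta> \<omega>))
             (\<lambda>s \<theta> \<omega>. partial i (\<gamma>\<^sub>2 \<circ> chart_inv c) (x s \<theta> \<omega>)) a b))"

definition HP_solution ::
    "('q::t2_space, 'n::finite) chart set \<Rightarrow> ('q, 'n) lagrangian \<Rightarrow> ('q \<Rightarrow> real) \<Rightarrow> ('q \<Rightarrow> real) \<Rightarrow>
     (real \<Rightarrow> real) \<Rightarrow> real \<Rightarrow> ('\<theta> set \<Rightarrow> real) \<Rightarrow> (real \<Rightarrow> '\<theta> \<Rightarrow> real) \<Rightarrow>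
     '\<omega> measure \<Rightarrow> (real \<Rightarrow> '\<omega> measure) \<Rightarrow> (real \<Rightarrow> '\<omega> \<Rightarrow> real) \<Rightarrow> real \<Rightarrow> real set \<Rightarrow>
     (real \<Rightarrow> '\<theta> \<Rightarrow> '\<omega> \<Rightarrow> 'q) \<Rightarrow> (real \<Rightarrow> '\<theta> \<Rightarrow> '\<omega> \<Rightarrow> ('q, 'n) chart \<Rightarrow> real^'n) \<Rightarrow>
     (real \<Rightarrow> '\<theta> \<Rightarrow> '\<omega> \<Rightarrow> ('q, 'n) chart \<Rightarrow> real^'n) \<Rightarrow> bool" where
  "HP_solution A \<L> \<gamma>\<^sub>1 \<gamma>\<^sub>2 \<alpha> \<rho> Cr L M F W t S q v p \<longleftrightarrow>
     chance_AE Cr M (\<lambda>\<theta> \<omega>. \<forall>s\<in>S. (q s \<theta> \<omega>, v s \<theta> \<omega>) \<in> tangent_bundle A) \<and>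
     hybrid_system A \<gamma>\<^sub>1 \<gamma>\<^sub>2 Cr L M F W S q p
       (\<lambda>i s \<theta> \<omega> c. v s \<theta> \<omega> c $ i)
       (\<lambda>i s \<theta> \<omega> c.
          partial i (\<lambda>x. lagr A \<L> c t x (v s \<theta> \<omega> c)) (chart_coord c (q s \<theta> \<omega>))
          - p s \<theta> \<omega> c $ i * frac_coeff \<alpha> \<rho> s t) \<and>
     chance_AE Cr M (\<lambda>\<theta> \<omega>. \<forall>s\<in>S. \<forall>c\<in>A. q s \<theta> \<omega> \<in> chart_dom c \<longrightarrow>
       (\<forall>i. p s \<theta> \<omega> c $ i =
          partial i (lagr A \<L> c t (chart_coord c (q s \<theta> \<omega>))) (v s \<theta> \<omega> c)))"

definition Hamilton_solution ::
    "('q::t2_space, 'n::finite) chart set \<Rightarrow> ('q, 'n) lagrangian \<Rightarrow> ('q \<Rightarrow> real) \<Rightarrow> ('q \<Rightarrow> real) \<Rightarrow>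
     (real \<Rightarrow> real) \<Rightarrow> real \<Rightarrow> ('\<theta> set \<Rightarrow> real) \<Rightarrow> (real \<Rightarrow> '\<theta> \<Rightarrow> real) \<Rightarrow>
     '\<omega> measure \<Rightarrow> (real \<Rightarrow> '\<omega> measure) \<Rightarrow> (real \<Rightarrow> '\<omega> \<Rightarrow> real) \<Rightarrow> real \<Rightarrow> real set \<Rightarrow>
     ('q, 'n) bundle_point set \<Rightarrow>
     (real \<Rightarrow> '\<theta> \<Rightarrow> '\<omega> \<Rightarrow> 'q) \<Rightarrow> (real \<Rightarrow> '\<theta> \<Rightarrow> '\<omega> \<Rightarrow> ('q, 'n) chart \<Rightarrow> real^'n) \<Rightarrow> bool" where
  "Hamilton_solution A \<L> \<gamma>\<^sub>1 \<gamma>\<^sub>2 \<alpha> \<rho> Cr L M F W t S D q p \<longleftrightarrow>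
     chance_AE Cr M (\<lambda>\<theta> \<omega>. \<forall>s\<in>S. (q s \<theta> \<omega>, p s \<theta> \<omega>) \<in> legendre A \<L> t ` D) \<and>
     hybrid_system A \<gamma>\<^sub>1 \<gamma>\<^sub>2 Cr L M F W S q p
       (\<lambda>i s \<theta> \<omega> c.
          partial i (hamiltonian A \<L> t D c (chart_coord c (q s \<theta> \<omega>))) (p s \<theta> \<omega> c))
       (\<lambda>i s \<theta> \<omega> c.
          - partial i (\<lambda>x. hamiltonian A \<L> t D c x (p s \<theta> \<omega> c)) (chart_coord c (q s \<theta> \<omega>))
          - p s \<theta> \<omega> c $ i * frac_coeff \<alpha> \<rho> s t)"

end

theory Submission
  imports Defs
begin

text \<open>
  In a chart the fibre derivative is the map \<open>(x, v) \<mapsto> (x, \<partial>G/\<partial>v)\<close>, which is \<open>C\<^sup>1\<close> and whose derivative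
  is block triangular with the Hessian as its second diagonal block.  By the inverse function
  theorem it is a local diffeomorphism, which yields both the Legendre domains and the
  differentiability of \<open>v\<close> as a function of \<open>(x, p)\<close>.  Differentiating \<open>H = p v - G\<close> then gives
  \<open>\<partial>H/\<partial>p = v\<close> and \<open>\<partial>H/\<partial>x = - \<partial>G/\<partial>x\<close>.  Hence, along processes related by the Legendre
  transformation, the two systems have almost surely the same drift at every time, while their
  Ito and Liu terms coincide literally.
\<close>

subsection \<open>The fibre derivative in a chart\<close>

text \<open>The chain rule along the line \<open>r \<mapsto> x + r *\<^sub>R axis i 1\<close>. It
  turns the one-variable \<open>deriv\<close> in \<open>partial\<close> into a value of the Frechet
  derivative, the form in which later derivatives are computed.\<close>

lemma partial_eq:
  assumes "(f has_derivative f') (at x)"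
  shows "partial i f x = f' (axis i 1)"
proof -
  have "((\<lambda>r. x + r *\<^sub>R axis i 1) has_derivative (\<lambda>r. r *\<^sub>R axis i 1)) (at 0)"
    by (auto intro!: derivative_eq_intros)
  moreover have "(f has_derivative f') (at (x + 0 *\<^sub>R axis i 1))"
    using assms by simp
  ultimately have "((\<lambda>r. f (x + r *\<^sub>R axis i 1)) has_derivative (\<lambda>r. f' (r *\<^sub>R axis i 1))) (at 0)"
    by (rule has_derivative_compose)
  moreover have "(\<lambda>r. f' (r *\<^sub>R axis i 1)) = (*) (f' (axis i 1))"
    using has_derivative_linear[OF assms] by (auto simp: linear_cmul mult.commute)
  ultimately show ?thesis
    unfolding partial_def by (intro DERIV_imp_deriv) (simp add: has_field_derivative_def)
qed

text \<open>By linearity of \<open>f'\<close>, after expanding \<open>w\<close> in the standard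
  basis. A vector of partial derivatives is thereby recognised as a differential, to which the chain
  rule applies.\<close>

lemma gradient_inner:
  assumes "(f has_derivative f') (at x)"
  shows "(\<chi> i. partial i f x) \<bullet> w = f' w"
proof -
  have lin: "linear f'"
    using assms by (rule has_derivative_linear)
  have "(\<chi> i. partial i f x) \<bullet> w = (\<Sum>i\<in>UNIV. f' (w $ i *\<^sub>R axis i 1))"
    by (simp add: inner_vec_def partial_eq[OF assms] linear_cmul[OF lin] mult.commute)
  also have "\<dots> = f' (\<Sum>i\<in>UNIV. w $ i *\<^sub>R axis i 1)"
    by (simp add: linear_sum[OF lin])
  also have "(\<Sum>i\<in>UNIV. w $ i *\<^sub>R axis i 1) = w"
    by (simp add: basis_expansion flip: scalar_mult_eq_scaleR)
  finally show ?thesis .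
qed

lemma has_derivative_vec_lambda:
  fixes f :: "'n::finite \<Rightarrow> 'a::real_normed_vector \<Rightarrow> real"
  assumes "\<And>i. (f i has_derivative f' i) (at x within S)"
  shows "((\<lambda>x. \<chi> i. f i x) has_derivative (\<lambda>w. \<chi> i. f' i w)) (at x within S)"
  using assms by (subst has_derivative_componentwise_within) (auto simp: Basis_vec_def inner_axis)

lemma frechet_derivative_works_on_open:
  assumes "f differentiable_on S" "open S" "x \<in> S"
  shows "(f has_derivative frechet_derivative f (at x)) (at x)"
  using assms by (metis at_within_open differentiable_on_def frechet_derivative_works)

text \<open>\<open>Ck_on\<close> states continuity of the derivative one basis direction at a time.
  In finite dimension this gives continuity as a map into bounded linear operators, the form taken
  by the inverse function theorem.\<close>

lemma C1_blinfun_derivative: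
  fixes f :: "'a::euclidean_space \<Rightarrow> 'b::euclidean_space"
  assumes "Ck_on (Suc 0) f S" "open S"
  obtains f' :: "'a \<Rightarrow> 'a \<Rightarrow>\<^sub>L 'b" where
    "\<And>x. x \<in> S \<Longrightarrow> (f has_derivative blinfun_apply (f' x)) (at x)" "continuous_on S f'"
proof -
  have der: "(f has_derivative frechet_derivative f (at x)) (at x)" if "x \<in> S" for x
    using assms that by (intro frechet_derivative_works_on_open[where S = S]) auto
  define f' where "f' x = Blinfun (frechet_derivative f (at x))" for x
  have apply_f': "blinfun_apply (f' x) = frechet_derivative f (at x)" if "x \<in> S" for x
    using has_derivative_bounded_linear[OF der[OF that]]
    by (simp add: f'_def bounded_linear_Blinfun_apply)
  have "continuous_on S (\<lambda>x. blinfun_apply (f' x) b)" if "b \<in> Basis" for b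
    using assms that by (simp add: apply_f' cong: continuous_on_cong)
  then have "continuous_on S f'"
    by (rule continuous_on_blinfun_componentwise)
  with der show thesis
    by (metis apply_f' that)
qed

text \<open>The base point is kept as first component so that \<open>x\<close> is a variable and not
  a parameter: a local inverse then gives \<open>v\<close> as a function of \<open>(x, p)\<close>
  jointly.\<close>

definition fibre_map ::
    "(real^'n::finite \<Rightarrow> real^'n \<Rightarrow> real) \<Rightarrow> (real^'n) \<times> (real^'n) \<Rightarrow> (real^'n) \<times> (real^'n)" where
  "fibre_map G z = (fst z, \<chi> i. partial i (G (fst z)) (snd z))"

text \<open>Freezing the time by \<open>Pair t\<close> reduces the claim to the joint function
  \<open>F\<close> of \<open>(t, x, v)\<close>. The momenta are derivatives of \<open>F\<close> in
  the directions \<open>(0, 0, axis i 1)\<close>, and these are C1 because \<open>F\<close> is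
  C2.\<close>

lemma fibre_map_C1:
  fixes f :: "real \<Rightarrow> real^'n::finite \<Rightarrow> real^'n \<Rightarrow> real"
  assumes "Ck_on 2 (\<lambda>(t, x, v). f t x v) (UNIV \<times> X \<times> UNIV)" "open X"
  shows "\<And>z. z \<in> X \<times> UNIV \<Longrightarrow> (\<lambda>z. f t (fst z) (snd z)) differentiable at z"
    and "\<exists>\<Phi>'. (\<forall>z\<in>X \<times> UNIV. (fibre_map (f t) has_derivative blinfun_apply (\<Phi>' z)) (at z)) \<and>
           continuous_on (X \<times> UNIV) \<Phi>'"
proof -
  define F where "F = (\<lambda>(t, x, v). f t x v)"
  let ?S = "UNIV \<times> X \<times> UNIV :: (real \<times> (real^'n) \<times> (real^'n)) set"
  have S: "open ?S"
    using assms(2) by (intro open_Times) auto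
  have Ck: "F differentiable_on ?S"
      "\<And>b. b \<in> Basis \<Longrightarrow> Ck_on (Suc 0) (\<lambda>z. frechet_derivative F (at z) b) ?S"
    using assms(1) by (simp_all add: numeral_2_eq_2 F_def)
  note dF = frechet_derivative_works_on_open[OF Ck(1) S]
  have d_at: "(Pair t has_derivative Pair 0) (at z)" for z :: "(real^'n) \<times> (real^'n)"
    by (auto intro!: derivative_eq_intros)
  have dft: "((\<lambda>z. f t (fst z) (snd z)) has_derivative
      (\<lambda>w. frechet_derivative F (at (t, z)) (0, w))) (at z)" if "z \<in> X \<times> UNIV" for z
    using has_derivative_compose[OF d_at, of F "frechet_derivative F (at (t, z))" z] dF[of "(t, z)"] that
    by (simp add: F_def case_prod_beta mem_Times_iff)
  then show "(\<lambda>z. f t (fst z) (snd z)) differentiable at z" if "z \<in> X \<times> UNIV" for z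
    using that differentiableI by blast
  let ?b = "\<lambda>i::'n. (0, 0, axis i 1) :: real \<times> (real^'n) \<times> (real^'n)"
  have partial_F: "partial i (f t (fst z)) (snd z) = frechet_derivative F (at (t, z)) (?b i)"
    if "z \<in> X \<times> UNIV" for z i
  proof -
    have "(Pair (fst z) has_derivative Pair 0) (at (snd z))"
      by (auto intro!: derivative_eq_intros)
    from has_derivative_compose[OF this, of "\<lambda>z. f t (fst z) (snd z)"] dft[OF that]
    have "(f t (fst z) has_derivative (\<lambda>w. frechet_derivative F (at (t, z)) (0, 0, w))) (at (snd z))"
      by simp
    then show ?thesis
      by (rule partial_eq)
  qed
  have "\<exists>f'. (\<forall>z\<in>?S. ((\<lambda>z. frechet_derivative F (at z) (?b i)) has_derivative blinfun_apply (f' z)) (at z))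
      \<and> continuous_on ?S f'" for i
  proof -
    have "?b i \<in> Basis"
      by (auto simp: Basis_prod_def axis_in_Basis_iff)
    from C1_blinfun_derivative[OF Ck(2)[OF this] S] show ?thesis
      by metis
  qed
  then obtain f' where f': "\<And>i z. z \<in> ?S \<Longrightarrow>
      ((\<lambda>z. frechet_derivative F (at z) (?b i)) has_derivative blinfun_apply (f' i z)) (at z)"
      "\<And>i. continuous_on ?S (f' i)"
    by metis
  \<comment> \<open>The derivative in block form: the base component is copied, and the second
    component collects the differentials of the momenta at increments \<open>(0, w)\<close>, without
    variation of time.\<close>
  define \<Phi>' where "\<Phi>' z = Blinfun (\<lambda>w. (fst w, \<chi> i. blinfun_apply (f' i (t, z)) (0, w)))" for z
  have lin: "bounded_linear (\<lambda>w. (fst w, \<chi> i. blinfun_apply (f' i (t, z)) (0, w)))" for z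
    unfolding linear_conv_bounded_linear[symmetric]
    by (rule linearI)
      (auto simp: vec_eq_iff blinfun.add_right[symmetric] blinfun.scaleR_right[symmetric]
        simp flip: real_scaleR_def)
  have apply_\<Phi>': "blinfun_apply (\<Phi>' z) = (\<lambda>w. (fst w, \<chi> i. blinfun_apply (f' i (t, z)) (0, w)))" for z
    by (simp add: \<Phi>'_def bounded_linear_Blinfun_apply lin)
  have "(fibre_map (f t) has_derivative blinfun_apply (\<Phi>' z)) (at z)" if z: "z \<in> X \<times> UNIV" for z
  proof -
    have "((\<lambda>z. frechet_derivative F (at (t, z)) (?b i)) has_derivative
        (\<lambda>w. blinfun_apply (f' i (t, z)) (0, w))) (at z)" for i
      using has_derivative_compose[OF d_at f'(1)] z by (auto simp: mem_Times_iff)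
    then have "((\<lambda>z. (fst z, \<chi> i. frechet_derivative F (at (t, z)) (?b i))) has_derivative blinfun_apply (\<Phi>' z)) (at z)"
      unfolding apply_\<Phi>'
      by (intro has_derivative_Pair has_derivative_vec_lambda has_derivative_fst has_derivative_ident)
    then show ?thesis
      by (rule has_derivative_transform_within_open[where s = "X \<times> UNIV"])
        (use z assms(2) in \<open>auto simp: fibre_map_def partial_F open_Times\<close>)
  qed
  moreover have "continuous_on (X \<times> UNIV) \<Phi>'"
  proof (rule continuous_on_blinfun_componentwise)
    fix w :: "(real^'n) \<times> (real^'n)"
    have "continuous_on (X \<times> UNIV) (\<lambda>z. f' i (t, z))" for i
      by (rule continuous_on_compose2[OF f'(2)]) (auto intro!: continuous_intros)
    then show "continuous_on (X \<times> UNIV) (\<lambda>z. blinfun_apply (\<Phi>' z) w)"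
      unfolding apply_\<Phi>' by (intro continuous_intros)
  qed
  ultimately show "\<exists>\<Phi>'. (\<forall>z\<in>X \<times> UNIV. (fibre_map (f t) has_derivative blinfun_apply (\<Phi>' z)) (at z)) \<and>
           continuous_on (X \<times> UNIV) \<Phi>'"
    by blast
qed

text \<open>The derivative preserves the first component, so a kernel vector is vertical. On
  vertical vectors the derivative is given by the transposed Hessian, which is invertible.\<close>

lemma fibre_map_derivative_inj:
  fixes G :: "real^'n::finite \<Rightarrow> real^'n \<Rightarrow> real"
  assumes d: "(fibre_map G has_derivative \<Phi>') (at (x, v))"
    and hess: "det (\<chi> i j. partial i (partial j (G x)) v) \<noteq> 0"
  shows "inj \<Phi>'"
proof -
  have lin: "linear \<Phi>'"
    using d has_derivative_linear by blast
  have "((\<lambda>z. fst (fibre_map G z)) has_derivative (\<lambda>w. fst (\<Phi>' w))) (at (x, v))"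
    using d by (rule has_derivative_fst)
  moreover have "((\<lambda>z. fst (fibre_map G z)) has_derivative fst) (at (x, v))"
    unfolding fibre_map_def by (auto intro!: derivative_eq_intros)
  ultimately have fst_\<Phi>': "fst (\<Phi>' w) = fst w" for w
    by (metis has_derivative_unique)
  have "(Pair x has_derivative Pair 0) (at v)"
    by (auto intro!: derivative_eq_intros)
  from has_derivative_compose[OF this d]
  have dv: "((\<lambda>u. snd (fibre_map G (x, u)) $ j) has_derivative (\<lambda>w. snd (\<Phi>' (0, w)) $ j)) (at v)" for j
    by (intro bounded_linear.has_derivative[OF bounded_linear_vec_nth] has_derivative_snd)
  then have hess_eq: "partial i (partial j (G x)) v = snd (\<Phi>' (0, axis i 1)) $ j" for i j
    using partial_eq[OF dv] by (simp add: fibre_map_def eta_contract_eq)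
  have lin2: "linear (\<lambda>w. snd (\<Phi>' (0, w)))"
    using linear_compose[OF linear_compose[OF _ lin] linear_snd, of "Pair 0"]
    by (auto simp: o_def linear_iff)
  \<comment> \<open>The column index of \<open>matrix\<close> is the direction of differentiation,
    which is the row index of the Hessian; hence the transpose, which has the same
    determinant.\<close>
  have "matrix (\<lambda>w. snd (\<Phi>' (0, w))) = transpose (\<chi> i j. partial i (partial j (G x)) v)"
    by (simp add: matrix_def transpose_def hess_eq)
  with hess have "inj (\<lambda>w. snd (\<Phi>' (0, w)))"
    using det_nz_iff_inj[OF lin2] by simp
  then have inj2: "snd (\<Phi>' (0, w)) = 0 \<Longrightarrow> w = 0" for w
    using linear_injective_0[OF lin2] by blast
  show ?thesis
    unfolding linear_injective_0[OF lin]
  proof safe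
    fix a b assume "\<Phi>' (a, b) = 0"
    with fst_\<Phi>'[of "(a, b)"] inj2[of b] show "(a, b) = 0"
      by (simp add: prod_eq_iff)
  qed
qed

text \<open>An injective linear map has a linear left inverse, and this is the kind of invertibility
  that \<open>inverse_function_theorem\<close> asks of the derivative.\<close>

lemma fibre_map_local_inverse:
  fixes G :: "real^'n::finite \<Rightarrow> real^'n \<Rightarrow> real"
  assumes "open N" "z0 \<in> N"
    and der: "\<And>z. z \<in> N \<Longrightarrow> (fibre_map G has_derivative blinfun_apply (\<Phi>' z)) (at z)"
    and cont: "continuous_on N \<Phi>'"
    and hess: "det (\<chi> i j. partial i (partial j (G (fst z0))) (snd z0)) \<noteq> 0"
  obtains U V h h' where "open U" "U \<subseteq> N" "z0 \<in> U" "open V" "fibre_map G z0 \<in> V"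
    "homeomorphism U V (fibre_map G) h" "(h has_derivative h') (at (fibre_map G z0))"
proof -
  have "inj (blinfun_apply (\<Phi>' z0))"
    using der[OF assms(2)] hess fibre_map_derivative_inj[of G _ "fst z0" "snd z0"] by simp
  then obtain k where k: "linear k" "k \<circ> blinfun_apply (\<Phi>' z0) = id"
    using linear_injective_left_inverse blinfun.bounded_linear_right bounded_linear.linear by metis
  then have "Blinfun k o\<^sub>L \<Phi>' z0 = id_blinfun"
    by (intro blinfun_eqI) (simp add: bounded_linear_Blinfun_apply linear_conv_bounded_linear pointfree_idE)
  from inverse_function_theorem[OF assms(1) der cont assms(2) this] show thesis
    using that by metis
qed

text \<open>The classical identity dH = v dp - (dG/dx) dx. Nothing is assumed about the smoothness
  of \<open>vel\<close>: near the image point it coincides with the velocity component of a local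
  inverse \<open>h\<close>, which is differentiable there.\<close>

lemma legendre_transform_has_derivative:
  fixes G :: "real^'n::finite \<Rightarrow> real^'n \<Rightarrow> real"
  assumes N: "open N" "(x, v) \<in> N"
    and der: "\<And>z. z \<in> N \<Longrightarrow> (fibre_map G has_derivative blinfun_apply (\<Phi>' z)) (at z)"
    and cont: "continuous_on N \<Phi>'"
    and hess: "det (\<chi> i j. partial i (partial j (G x)) v) \<noteq> 0"
    and G: "((\<lambda>z. G (fst z) (snd z)) has_derivative G') (at (x, v))"
    and vel: "\<And>z. z \<in> N \<Longrightarrow> vel (fibre_map G z) = snd z"
  shows "((\<lambda>y. snd y \<bullet> vel y - G (fst y) (vel y)) has_derivative
    (\<lambda>w. snd w \<bullet> v - G' (fst w, 0))) (at (fibre_map G (x, v)))"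
proof -
  have "det (\<chi> i j. partial i (partial j (G (fst (x, v)))) (snd (x, v))) \<noteq> 0"
    using hess by simp
  from fibre_map_local_inverse[OF N der cont this]
  obtain U V h h' where U: "open U" "U \<subseteq> N" "(x, v) \<in> U"
    and V: "open V" "fibre_map G (x, v) \<in> V"
    and hom: "homeomorphism U V (fibre_map G) h"
    and h': "(h has_derivative h') (at (fibre_map G (x, v)))"
    by metis
  define y0 where "y0 = fibre_map G (x, v)"
  have h_y0: "h y0 = (x, v)"
    using hom U(3) by (simp add: y0_def homeomorphism_apply1)
  have fst_h: "fst (h y) = fst y" and vel_h: "vel y = snd (h y)" if "y \<in> V" for y
  proof -
    have "h y \<in> U" "fibre_map G (h y) = y"
      using hom that by (auto simp: homeomorphism_def)
    then show "fst (h y) = fst y" "vel y = snd (h y)"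
      using U(2) vel[of "h y"] by (metis fibre_map_def fst_conv, auto)
  qed
  \<comment> \<open>The inverse function theorem does not describe \<open>h'\<close> explicitly. As
    \<open>h\<close> keeps base points near \<open>y0\<close>, uniqueness of derivatives shows that
    \<open>h'\<close> keeps the first component.\<close>
  have "((\<lambda>y. fst (h y)) has_derivative (\<lambda>w. fst (h' w))) (at y0)"
    using h' unfolding y0_def by (rule has_derivative_fst)
  then have "(fst has_derivative (\<lambda>w. fst (h' w))) (at y0)"
    by (rule has_derivative_transform_within_open[OF _ V(1)]) (use V fst_h in \<open>auto simp: y0_def\<close>)
  moreover have "(fst has_derivative fst) (at y0)"
    by (auto intro!: derivative_eq_intros)
  ultimately have fst_h': "fst (h' w) = fst w" for w
    by (metis has_derivative_unique)
  have lin: "linear G'"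
    using G has_derivative_linear by blast
  have "(Pair x has_derivative Pair 0) (at v)"
    by (auto intro!: derivative_eq_intros)
  from has_derivative_compose[OF this G] have "(G x has_derivative (\<lambda>w. G' (0, w))) (at v)"
    by simp
  \<comment> \<open>On vertical increments \<open>G'\<close> is the pairing with the momentum
    \<open>snd y0\<close>.\<close>
  from gradient_inner[OF this] have p: "G' (0, w) = snd y0 \<bullet> w" for w
    by (simp add: y0_def fibre_map_def)
  have "((\<lambda>y. G (fst (h y)) (snd (h y))) has_derivative (\<lambda>w. G' (h' w))) (at y0)"
    using has_derivative_compose[OF h'[folded y0_def], of "\<lambda>z. G (fst z) (snd z)" G'] G
    by (simp add: h_y0)
  then have "((\<lambda>y. snd y \<bullet> snd (h y) - G (fst (h y)) (snd (h y))) has_derivative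
      (\<lambda>w. (snd y0 \<bullet> snd (h' w) + snd w \<bullet> snd (h y0)) - G' (h' w))) (at y0)"
    by (intro has_derivative_diff has_derivative_inner has_derivative_snd has_derivative_ident
        h'[folded y0_def])
  txt \<open>The variation of the velocity drops out because the momentum is the fibre derivative of \<open>G\<close>.\<close>
  moreover have "(\<lambda>w. (snd y0 \<bullet> snd (h' w) + snd w \<bullet> snd (h y0)) - G' (h' w)) =
      (\<lambda>w. snd w \<bullet> v - G' (fst w, 0))"
  proof
    fix w
    have "G' (h' w) = G' (fst w, 0) + G' (0, snd (h' w))"
      using linear_add[OF lin, of "(fst w, 0)" "(0, snd (h' w))"] fst_h'[of w]
      by (metis add.left_neutral add.right_neutral add_Pair prod.collapse)
    then show "(snd y0 \<bullet> snd (h' w) + snd w \<bullet> snd (h y0)) - G' (h' w) = snd w \<bullet> v - G' (fst w, 0)"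
      by (simp add: p h_y0)
  qed
  ultimately have "((\<lambda>y. snd y \<bullet> snd (h y) - G (fst (h y)) (snd (h y))) has_derivative
      (\<lambda>w. snd w \<bullet> v - G' (fst w, 0))) (at y0)"
    by simp
  then show ?thesis
    unfolding y0_def
    by (rule has_derivative_transform_within_open[OF _ V]) (simp add: fst_h vel_h)
qed

subsection \<open>Tangent and cotangent vectors in an atlas\<close>

locale atlas =
  fixes A :: "('q::t2_space, 'n::finite) chart set"
  assumes smooth: "smooth_atlas A"
begin

section \<open>Charts, overlaps and derivatives of transition maps\<close>

lemma chart_homeomorphism:
  assumes "c \<in> A"
  shows "homeomorphism (chart_dom c) (chart_image c) (chart_coord c) (chart_inv c)"
  using smooth assms unfolding smooth_atlas_def by blast

lemma open_chart_dom: "c \<in> A \<Longrightarrow> open (chart_dom c)"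
  and open_chart_image: "c \<in> A \<Longrightarrow> open (chart_image c)"
  using smooth unfolding smooth_atlas_def by blast+

lemma chart_inv_coord: "c \<in> A \<Longrightarrow> m \<in> chart_dom c \<Longrightarrow> chart_inv c (chart_coord c m) = m"
  using chart_homeomorphism homeomorphism_apply1 by blast

lemma chart_inv_in_dom: "x \<in> chart_image c \<Longrightarrow> chart_inv c x \<in> chart_dom c"
  by (rule inv_into_into)

lemma chart_coord_inv: "x \<in> chart_image c \<Longrightarrow> chart_coord c (chart_inv c x) = x"
  by (rule f_inv_into_f)

abbreviation overlap :: "('q, 'n) chart \<Rightarrow> ('q, 'n) chart \<Rightarrow> (real^'n) set" where
  "overlap c d \<equiv> chart_coord c ` (chart_dom c \<inter> chart_dom d)"

lemma overlapD:
  assumes "c \<in> A" "x \<in> overlap c d"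
  shows "x \<in> chart_image c" "chart_inv c x \<in> chart_dom c" "chart_inv c x \<in> chart_dom d"
  using assms chart_inv_coord by auto

lemma overlapI:
  assumes "x \<in> chart_image c" "chart_inv c x \<in> chart_dom d"
  shows "x \<in> overlap c d"
  using assms chart_coord_inv chart_inv_in_dom by (metis IntI image_eqI)

text \<open>A chart is a homeomorphism onto an open set of the model space, so it sends open subsets
  of its domain to open sets of the model space.\<close>

lemma open_overlap:
  assumes "c \<in> A" "d \<in> A"
  shows "open (overlap c d)"
proof -
  have "openin (top_of_set (chart_dom c)) (chart_dom c \<inter> chart_dom d)"
    using assms open_chart_dom by (simp add: openin_open_Int)
  then have "openin (top_of_set (chart_image c)) (overlap c d)"
    using chart_homeomorphism[OF assms(1)] homeomorphism_imp_open_map by blast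
  then show ?thesis
    using open_chart_image[OF assms(1)] openin_open_trans by blast
qed

lemma transition_Ck: "c \<in> A \<Longrightarrow> d \<in> A \<Longrightarrow> Ck_on k (chart_coord d \<circ> chart_inv c) (overlap c d)"
  using smooth unfolding smooth_atlas_def by blast

lemma transition_has_derivative:
  assumes "c \<in> A" "d \<in> A" "m \<in> chart_dom c \<inter> chart_dom d"
  shows "((chart_coord d \<circ> chart_inv c) has_derivative transition_deriv c d m) (at (chart_coord c m))"
  unfolding transition_deriv_def
  by (rule frechet_derivative_works_on_open[where S = "overlap c d"])
    (use open_overlap transition_Ck[of c d "Suc 0"] assms in auto)

lemma transition_deriv_same:
  assumes "c \<in> A" "m \<in> chart_dom c"
  shows "transition_deriv c c m w = w"
proof -
  have "((\<lambda>x. x) has_derivative transition_deriv c c m) (at (chart_coord c m))"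
    by (rule has_derivative_transform_within_open[OF transition_has_derivative open_chart_image[of c]])
      (use assms chart_inv_coord in auto)
  then show ?thesis
    using has_derivative_unique has_derivative_ident by metis
qed

text \<open>The cocycle identity of the transition maps, differentiated by the chain rule. The
  composite agrees with the direct transition map on the open set \<open>overlap b c\<close>, which
  suffices for equal derivatives.\<close>

lemma transition_deriv_compose:
  assumes "b \<in> A" "c \<in> A" "d \<in> A" "m \<in> chart_dom b" "m \<in> chart_dom c" "m \<in> chart_dom d"
  shows "transition_deriv c d m (transition_deriv b c m w) = transition_deriv b d m w"
proof -
  have bc: "((chart_coord c \<circ> chart_inv b) has_derivative transition_deriv b c m) (at (chart_coord b m))"
    and cd: "((chart_coord d \<circ> chart_inv c) has_derivative transition_deriv c d m) (at (chart_coord c m))"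
    and bd: "((chart_coord d \<circ> chart_inv b) has_derivative transition_deriv b d m) (at (chart_coord b m))"
    using assms by (auto intro: transition_has_derivative)
  have "((chart_coord d \<circ> chart_inv c) \<circ> (chart_coord c \<circ> chart_inv b) has_derivative
      transition_deriv c d m \<circ> transition_deriv b c m) (at (chart_coord b m))"
    using bc cd assms by (intro diff_chain_at) (simp_all add: chart_inv_coord)
  then have "(chart_coord d \<circ> chart_inv b has_derivative
      transition_deriv c d m \<circ> transition_deriv b c m) (at (chart_coord b m))"
  proof (rule has_derivative_transform_within_open)
    show "open (overlap b c)" "chart_coord b m \<in> overlap b c"
      using assms open_overlap by auto
    fix x assume "x \<in> overlap b c"
    then show "(chart_coord d \<circ> chart_inv c \<circ> (chart_coord c \<circ> chart_inv b)) x =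
        (chart_coord d \<circ> chart_inv b) x"
      using overlapD(3)[OF assms(1)] assms(2) by (simp add: chart_inv_coord)
  qed
  then show ?thesis
    using bd has_derivative_unique by (metis comp_apply)
qed

section \<open>Points of the two bundles and their components in one chart\<close>

lemma fst_tangent_point [simp]: "fst (tangent_point A c x v) = chart_inv c x"
  by (simp add: tangent_point_def Let_def)

lemma snd_tangent_point:
  assumes "c \<in> A" "x \<in> chart_image c"
  shows "snd (tangent_point A c x v) c = v"
  using assms chart_inv_in_dom[OF assms(2)]
  by (simp add: tangent_point_def Let_def transition_deriv_same)

text \<open>All components are images of \<open>v\<close> under transition derivatives, so the
  transformation law is the cocycle identity \<open>transition_deriv_compose\<close>.\<close>

lemma tangent_point_in_bundle:
  assumes "c \<in> A" "x \<in> chart_image c"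
  shows "tangent_point A c x v \<in> tangent_bundle A"
  using assms chart_inv_in_dom[OF assms(2)]
  by (auto simp: tangent_point_def tangent_bundle_def Let_def transition_deriv_compose)

lemma tangent_bundleD:
  assumes "(m, X) \<in> tangent_bundle A" "c \<in> A" "d \<in> A" "m \<in> chart_dom c" "m \<in> chart_dom d"
  shows "X d = transition_deriv c d m (X c)"
  using assms unfolding tangent_bundle_def by blast

lemma cotangent_bundleD:
  assumes "(m, P) \<in> cotangent_bundle A" "c \<in> A" "d \<in> A" "m \<in> chart_dom c" "m \<in> chart_dom d"
  shows "P c \<bullet> w = P d \<bullet> transition_deriv c d m w"
  using assms unfolding cotangent_bundle_def by blast

text \<open>This normalisation reduces an equality of bundle points over \<open>m\<close> to their
  components in charts of the atlas around \<open>m\<close>.\<close>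

lemma bundle_outside_chart:
  assumes "(m, X) \<in> tangent_bundle A \<union> cotangent_bundle A" "\<not> (c \<in> A \<and> m \<in> chart_dom c)"
  shows "X c = 0"
  using assms unfolding tangent_bundle_def cotangent_bundle_def by blast

text \<open>The transformation law recovers every component from the one in \<open>c\<close>; a
  tangent vector is thus determined by its components in a single chart.\<close>

lemma tangent_point_eq:
  assumes "(m, X) \<in> tangent_bundle A" "c \<in> A" "m \<in> chart_dom c"
  shows "tangent_point A c (chart_coord c m) (X c) = (m, X)"
  using bundle_outside_chart[of m X] assms
  by (auto simp: tangent_point_def Let_def chart_inv_coord fun_eq_iff
      simp flip: tangent_bundleD[OF assms(1,2) _ assms(3)])

text \<open>The point built in \<open>c\<close> has component
  \<open>transition_deriv c d m v\<close> in \<open>d\<close> and is recovered from it by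
  \<open>tangent_point_eq\<close>. This is what relates the local Lagrangians of two charts.\<close>

lemma tangent_point_transition:
  assumes "c \<in> A" "d \<in> A" "m \<in> chart_dom c" "m \<in> chart_dom d"
  shows "tangent_point A d (chart_coord d m) (transition_deriv c d m v) =
    tangent_point A c (chart_coord c m) v"
proof -
  obtain X where X: "tangent_point A c (chart_coord c m) v = (m, X)"
    using assms by (metis chart_inv_coord fst_tangent_point prod.collapse)
  then have "(m, X) \<in> tangent_bundle A" "X d = transition_deriv c d m v"
    using tangent_point_in_bundle[of c "chart_coord c m" v] assms
    by (auto simp: tangent_point_def Let_def chart_inv_coord)
  then show ?thesis
    using tangent_point_eq assms X by metis
qed

text \<open>Covectors transform by the transposed transition derivative, so testing the law on the
  axis vectors of \<open>d\<close> recovers \<open>P d\<close> from \<open>P c\<close>.\<close>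

lemma cotangent_point_eq:
  assumes "(m, P) \<in> cotangent_bundle A" "c \<in> A" "m \<in> chart_dom c"
  shows "cotangent_point A c (chart_coord c m) (P c) = (m, P)"
proof -
  have "(\<chi> i. P c \<bullet> transition_deriv d c m (axis i 1)) = P d" if "d \<in> A" "m \<in> chart_dom d" for d
  proof -
    have "P d \<bullet> w = P c \<bullet> transition_deriv d c m w" for w
      using cotangent_bundleD[OF assms(1) that(1) assms(2)] that assms(3) by blast
    from this[symmetric] show ?thesis
      by (simp add: vec_eq_iff inner_axis)
  qed
  then show ?thesis
    using bundle_outside_chart[of m P] assms
    by (auto simp: cotangent_point_def Let_def chart_inv_coord fun_eq_iff)
qed

end

subsection \<open>The Legendre transformation\<close>

text \<open>The observed time \<open>t\<close> is fixed because the fibre derivative and the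
  Hamiltonian are formed at that time, while the processes run in \<open>s\<close>.\<close>

locale lagrangian_atlas = atlas A
  for A :: "('q::t2_space, 'n::finite) chart set" +
  fixes \<L> :: "('q, 'n) lagrangian" and t :: real
  assumes regular: "regular_lagrangian A \<L>"
    and hyperregular: "hyperregular A \<L>"
begin

abbreviation G :: "('q, 'n) chart \<Rightarrow> real^'n \<Rightarrow> real^'n \<Rightarrow> real" where
  "G c \<equiv> lagr A \<L> c t"

lemma lagr_Ck:
  "c \<in> A \<Longrightarrow> Ck_on 2 (\<lambda>(t, x, v). lagr A \<L> c t x v) (UNIV \<times> chart_image c \<times> UNIV)"
  using regular by (auto simp: regular_lagrangian_def C2_Lipschitz_on_def)

text \<open>The derivatives in \<open>v\<close> and in \<open>x\<close> are restrictions of one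
  joint derivative \<open>G'\<close>, so later computations can combine them.\<close>

lemma lagr_differentiable:
  assumes "c \<in> A" "x \<in> chart_image c"
  obtains G' where "((\<lambda>z. G c (fst z) (snd z)) has_derivative G') (at (x, v))"
    "(G c x has_derivative (\<lambda>w. G' (0, w))) (at v)"
    "((\<lambda>x. G c x v) has_derivative (\<lambda>w. G' (w, 0))) (at x)"
proof -
  obtain G' where G': "((\<lambda>z. G c (fst z) (snd z)) has_derivative G') (at (x, v))"
    using fibre_map_C1(1)[OF lagr_Ck[OF assms(1)] open_chart_image[OF assms(1)],
        where t = t and z = "(x, v)"] assms
    by (auto simp: differentiable_def)
  have "(Pair x has_derivative Pair 0) (at v)" "((\<lambda>x. (x, v)) has_derivative (\<lambda>w. (w, 0))) (at x)"
    by (auto intro!: derivative_eq_intros)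
  from this[THEN has_derivative_compose, OF G'] G' that show thesis
    by simp
qed

lemma fibre_map_lagr_C1:
  assumes "c \<in> A"
  obtains \<Phi>' where
    "\<And>z. z \<in> chart_image c \<times> UNIV \<Longrightarrow> (fibre_map (G c) has_derivative blinfun_apply (\<Phi>' z)) (at z)"
    "continuous_on (chart_image c \<times> UNIV) \<Phi>'"
  using fibre_map_C1(2)[OF lagr_Ck[OF assms] open_chart_image[OF assms], where t = t] by blast

lemma hessian_nonzero:
  assumes "c \<in> A" "x \<in> chart_image c"
  shows "det (\<chi> i j. partial i (partial j (G c x)) v) \<noteq> 0"
  using hyperregular assms unfolding hyperregular_def by blast

lemma snd_legendre:
  assumes "c \<in> A" "m \<in> chart_dom c"
  shows "snd (legendre A \<L> t (m, X)) c = snd (fibre_map (G c) (chart_coord c m, X c))"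
  using assms by (simp add: legendre_def fibre_map_def)

text \<open>On the fibre over \<open>m\<close>, the Lagrangian in \<open>c\<close> is the one in
  \<open>d\<close> composed with the linear map \<open>transition_deriv c d m\<close>. Differentials
  pull back under composition, which is the law for covectors.\<close>

lemma legendre_in_cotangent_bundle:
  assumes "(m, X) \<in> tangent_bundle A"
  shows "legendre A \<L> t (m, X) \<in> cotangent_bundle A"
proof -
  have covariance: "(\<chi> i. partial i (G c (chart_coord c m)) (X c)) \<bullet> w =
      (\<chi> i. partial i (G d (chart_coord d m)) (X d)) \<bullet> transition_deriv c d m w"
    if "c \<in> A" "d \<in> A" "m \<in> chart_dom c" "m \<in> chart_dom d" for c d w
  proof -
    have Xd: "X d = transition_deriv c d m (X c)"
      using tangent_bundleD[OF assms] that by blast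
    have "chart_coord d m \<in> chart_image d"
      using that by simp
    then obtain G' where G': "(G d (chart_coord d m) has_derivative G') (at (X d))"
      by (rule lagr_differentiable[OF \<open>d \<in> A\<close>])
    \<comment> \<open>Being linear, the change of velocity coordinates is its own
      derivative.\<close>
    have T: "(transition_deriv c d m has_derivative transition_deriv c d m) (at (X c))"
      using transition_has_derivative[of c d m] that
      by (intro bounded_linear_imp_has_derivative has_derivative_bounded_linear) auto
    have "((\<lambda>u. G d (chart_coord d m) (transition_deriv c d m u)) has_derivative
        (\<lambda>w. G' (transition_deriv c d m w))) (at (X c))"
      using has_derivative_compose[OF T] G' Xd by simp
    moreover have "G c (chart_coord c m) = (\<lambda>u. G d (chart_coord d m) (transition_deriv c d m u))"
      using that by (simp add: fun_eq_iff lagr_def tangent_point_transition)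
    ultimately have "(G c (chart_coord c m) has_derivative (\<lambda>w. G' (transition_deriv c d m w))) (at (X c))"
      by simp
    with G' show ?thesis
      by (simp add: gradient_inner)
  qed
  show ?thesis
    by (auto simp: legendre_def cotangent_bundle_def intro: covariance)
qed

text \<open>Both sides are covectors over the same point with the same component in
  \<open>c\<close>. The identity translates \<open>legendre\<close> into \<open>fibre_map\<close>
  and so gives access to \<open>legendre_inv\<close> in coordinates.\<close>

lemma legendre_tangent_point:
  assumes "c \<in> A" "x \<in> chart_image c"
  shows "legendre A \<L> t (tangent_point A c x v) =
    cotangent_point A c x (snd (fibre_map (G c) (x, v)))"
proof -
  define m X where "m = chart_inv c x" and "X = snd (tangent_point A c x v)"
  have mX: "tangent_point A c x v = (m, X)" "X c = v" "m \<in> chart_dom c" "chart_coord c m = x"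
    using snd_tangent_point[OF assms] chart_inv_in_dom[OF assms(2)] chart_coord_inv[OF assms(2)]
    by (auto simp: m_def X_def prod_eq_iff)
  obtain P where P: "legendre A \<L> t (m, X) = (m, P)"
    by (simp add: legendre_def)
  then have "P c = snd (fibre_map (G c) (x, v))"
    using snd_legendre[of c m X] mX assms by simp
  moreover have "(m, P) \<in> cotangent_bundle A"
    using legendre_in_cotangent_bundle tangent_point_in_bundle[OF assms, of v] mX P by metis
  ultimately show ?thesis
    using cotangent_point_eq[of m P c] mX P assms by simp
qed

text \<open>The inverse function theorem in a chart \<open>c\<close> around the base point gives an
  open \<open>U\<close> on which \<open>fibre_map\<close> is injective, and \<open>D\<close>
  consists of the vectors with coordinates in \<open>U\<close>. Injectivity passes to
  \<open>D\<close> since components in \<open>c\<close> determine a vector; openness has to be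
  checked in every chart \<open>d\<close>.\<close>

lemma legendre_domain_exists:
  assumes "z \<in> tangent_bundle A"
  shows "\<exists>D. legendre_domain A \<L> t D \<and> z \<in> D"
proof -
  obtain m0 X0 where z: "z = (m0, X0)"
    by (cases z)
  obtain c where c: "c \<in> A" "m0 \<in> chart_dom c"
    using smooth unfolding smooth_atlas_def by blast
  let ?N = "chart_image c \<times> (UNIV :: (real^'n) set)"
  obtain \<Phi>' where
    "\<And>z. z \<in> ?N \<Longrightarrow> (fibre_map (G c) has_derivative blinfun_apply (\<Phi>' z)) (at z)"
    "continuous_on ?N \<Phi>'"
    using fibre_map_lagr_C1[OF c(1)] by blast
  moreover have "det (\<chi> i j. partial i (partial j (G c (fst (chart_coord c m0, X0 c))))
      (snd (chart_coord c m0, X0 c))) \<noteq> 0"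
    using hessian_nonzero c by simp
  moreover have "open ?N" "(chart_coord c m0, X0 c) \<in> ?N"
    using c open_chart_image by (auto intro: open_Times)
  ultimately obtain U V h where U: "open U" "(chart_coord c m0, X0 c) \<in> U"
    and hom: "homeomorphism U V (fibre_map (G c)) h"
    using fibre_map_local_inverse[of ?N "(chart_coord c m0, X0 c)" "G c" \<Phi>'] by metis
  have inj: "inj_on (fibre_map (G c)) U"
    using homeomorphism_apply1[OF hom] by (rule inj_on_inverseI)
  define D where "D = {(m, X) \<in> tangent_bundle A. m \<in> chart_dom c \<and> (chart_coord c m, X c) \<in> U}"
  have "open {(x, v). x \<in> chart_image d \<and> tangent_point A d x v \<in> D}" if d: "d \<in> A" for d
  proof -
    \<comment> \<open>The change of tangent bundle coordinates from \<open>d\<close> to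
      \<open>c\<close>; the set in question is the preimage of \<open>U\<close> under it.\<close>
    let ?\<tau> = "\<lambda>z. ((chart_coord c \<circ> chart_inv d) (fst z), transition_deriv d c (chart_inv d (fst z)) (snd z))"
    let ?O = "overlap d c \<times> (UNIV :: (real^'n) set)"
    obtain f' where f': "\<And>x. x \<in> overlap d c \<Longrightarrow>
        ((chart_coord c \<circ> chart_inv d) has_derivative blinfun_apply (f' x)) (at x)"
      "continuous_on (overlap d c) f'"
      using C1_blinfun_derivative[OF transition_Ck[OF d c(1)] open_overlap[OF d c(1)]] by blast
    \<comment> \<open>Written as an operator depending continuously on \<open>x\<close>, the
      transition derivative is jointly continuous in base point and velocity.\<close>
    have tr: "transition_deriv d c (chart_inv d x) = blinfun_apply (f' x)" if "x \<in> overlap d c" for x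
      using frechet_derivative_at[OF f'(1)[OF that]] overlapD[OF d that]
      by (simp add: transition_deriv_def chart_coord_inv)
    have "continuous_on (overlap d c) (chart_coord c \<circ> chart_inv d)"
      using transition_Ck[OF d c(1), of 0] by simp
    then have "continuous_on ?O
        (\<lambda>z. ((chart_coord c \<circ> chart_inv d) (fst z), blinfun_apply (f' (fst z)) (snd z)))"
      by (intro continuous_on_Pair blinfun.continuous_on
          continuous_on_compose2[OF f'(2), of _ fst]
          continuous_on_compose2[of "overlap d c" "chart_coord c \<circ> chart_inv d" _ fst]
          continuous_on_fst continuous_on_snd continuous_on_id) auto
    then have "continuous_on ?O ?\<tau>"
      by (rule continuous_on_eq) (auto simp: tr simp del: comp_apply)
    then have "open (?O \<inter> ?\<tau> -` U)"
      by (rule continuous_open_preimage) (use U(1) open_overlap[OF d c(1)] in \<open>auto intro: open_Times\<close>)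
    moreover have "{(x, v). x \<in> chart_image d \<and> tangent_point A d x v \<in> D} = ?O \<inter> ?\<tau> -` U"
    proof (intro set_eqI)
      fix z :: "(real^'n) \<times> (real^'n)"
      obtain x v where xv: "z = (x, v)"
        by (cases z)
      show "z \<in> {(x, v). x \<in> chart_image d \<and> tangent_point A d x v \<in> D} \<longleftrightarrow> z \<in> ?O \<inter> ?\<tau> -` U"
      proof (cases "x \<in> overlap d c")
        case True
        then obtain X where "tangent_point A d x v = (chart_inv d x, X)"
            "X c = transition_deriv d c (chart_inv d x) v"
          using overlapD[OF d True] c by (auto simp: tangent_point_def Let_def)
        then show ?thesis
          using True overlapD[OF d True] tangent_point_in_bundle[OF d, of x v]
          by (auto simp: xv D_def case_prod_beta)
      next
        \<comment> \<open>Vectors of \<open>D\<close> lie over the domain of \<open>c\<close>, so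
          both sides fail off the overlap.\<close>
        case False
        then show ?thesis
          using overlapI[of x d c] by (auto simp: xv D_def case_prod_beta)
      qed
    qed
    ultimately show ?thesis
      by simp
  qed
  moreover have "inj_on (legendre A \<L> t) D"
  proof (intro inj_onI)
    fix y y' assume y: "y \<in> D" "y' \<in> D" "legendre A \<L> t y = legendre A \<L> t y'"
    obtain m X m' X' where yy: "y = (m, X)" "y' = (m', X')"
      by (cases y, cases y')
    have m: "m' = m"
      using y(3) by (simp add: yy legendre_def)
    have tangent: "(m, X) \<in> tangent_bundle A" "(m, X') \<in> tangent_bundle A"
      and mc: "m \<in> chart_dom c" and mU: "(chart_coord c m, X c) \<in> U" "(chart_coord c m, X' c) \<in> U"
      using y(1,2) by (auto simp: yy m D_def)
    have "snd (fibre_map (G c) (chart_coord c m, X c)) = snd (fibre_map (G c) (chart_coord c m, X' c))"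
      using y(3) snd_legendre[OF c(1) mc] by (metis m yy)
    then have "fibre_map (G c) (chart_coord c m, X c) = fibre_map (G c) (chart_coord c m, X' c)"
      by (simp add: fibre_map_def)
    then have "X c = X' c"
      using inj_onD[OF inj _ mU] by simp
    then show "y = y'"
      using tangent[THEN tangent_point_eq, OF c(1) mc] yy m by metis
  qed
  moreover have "z \<in> D"
    using assms c U by (auto simp: D_def z)
  moreover have "D \<subseteq> tangent_bundle A"
    by (auto simp: D_def)
  ultimately show ?thesis
    unfolding legendre_domain_def by blast
qed

text \<open>In the chart, \<open>vel\<close> is the velocity that enters the Hamiltonian, and it
  inverts the fibre derivative on the open set \<open>N\<close>. Hence
  \<open>legendre_transform_has_derivative\<close> gives the joint derivative in
  \<open>(x, p)\<close>, whose restrictions are the two partial derivatives.\<close>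

lemma hamiltonian_partials:
  assumes D: "legendre_domain A \<L> t D" "(m, X) \<in> D"
    and P: "legendre A \<L> t (m, X) = (m, P)"
    and c: "c \<in> A" "m \<in> chart_dom c"
  shows "partial i (hamiltonian A \<L> t D c (chart_coord c m)) (P c) = X c $ i" (is ?p)
    and "partial i (\<lambda>x. hamiltonian A \<L> t D c x (P c)) (chart_coord c m) =
      - partial i (\<lambda>x. G c x (X c)) (chart_coord c m)" (is ?q)
proof -
  define N where "N = {(x, v). x \<in> chart_image c \<and> tangent_point A c x v \<in> D}"
  define vel where "vel y = snd (legendre_inv A \<L> t D (cotangent_point A c (fst y) (snd y))) c" for y
  define x where "x = chart_coord c m"
  have x: "x \<in> chart_image c"
    using c by (simp add: x_def)
  have N: "open N" "N \<subseteq> chart_image c \<times> UNIV"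
    using D c by (auto simp: N_def legendre_domain_def)
  have "(m, X) \<in> tangent_bundle A"
    using D by (auto simp: legendre_domain_def)
  then have xN: "(x, X c) \<in> N"
    using tangent_point_eq c D x by (simp add: N_def x_def)
  obtain \<Phi>' where \<Phi>':
    "\<And>z. z \<in> chart_image c \<times> UNIV \<Longrightarrow> (fibre_map (G c) has_derivative blinfun_apply (\<Phi>' z)) (at z)"
    "continuous_on (chart_image c \<times> UNIV) \<Phi>'"
    using fibre_map_lagr_C1[OF c(1)] by blast
  obtain G' where G': "((\<lambda>z. G c (fst z) (snd z)) has_derivative G') (at (x, X c))"
    "((\<lambda>x. G c x (X c)) has_derivative (\<lambda>w. G' (w, 0))) (at x)"
    using lagr_differentiable c(1) x by blast
  \<comment> \<open>Injectivity on \<open>D\<close> makes \<open>inv_into\<close> return the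
    original vector and not another one with the same momentum.\<close>
  have vel: "vel (fibre_map (G c) z) = snd z" if "z \<in> N" for z
  proof -
    obtain y v where z: "z = (y, v)"
      by (cases z)
    have "y \<in> chart_image c" "tangent_point A c y v \<in> D"
      using that by (auto simp: z N_def)
    moreover from this have "legendre_inv A \<L> t D (cotangent_point A c y (snd (fibre_map (G c) z))) =
        tangent_point A c y v"
      using D by (simp add: z inv_into_f_f legendre_domain_def flip: legendre_tangent_point[OF c(1)])
    ultimately show ?thesis
      using c(1) by (simp add: z vel_def fibre_map_def snd_tangent_point)
  qed
  have "fibre_map (G c) (x, X c) = (x, P c)"
    using snd_legendre[OF c, of X] P by (simp add: prod_eq_iff fibre_map_def x_def)
  moreover have "hamiltonian A \<L> t D c (fst y) (snd y) = snd y \<bullet> vel y - G c (fst y) (vel y)" for y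
    by (simp add: hamiltonian_def vel_def inner_vec_def Let_def)
  moreover have "((\<lambda>y. snd y \<bullet> vel y - G c (fst y) (vel y)) has_derivative
      (\<lambda>w. snd w \<bullet> X c - G' (fst w, 0))) (at (fibre_map (G c) (x, X c)))"
    using legendre_transform_has_derivative[OF N(1) xN \<Phi>'(1)
        continuous_on_subset[OF \<Phi>'(2) N(2)] hessian_nonzero[OF c(1) x] G'(1) vel] N(2)
    by blast
  ultimately have H: "((\<lambda>y. hamiltonian A \<L> t D c (fst y) (snd y)) has_derivative
      (\<lambda>w. snd w \<bullet> X c - G' (fst w, 0))) (at (x, P c))"
    by simp
  have "(Pair x has_derivative Pair 0) (at (P c))" "((\<lambda>x. (x, P c)) has_derivative (\<lambda>w. (w, 0))) (at x)"
    by (auto intro!: derivative_eq_intros)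
  note d = this[THEN has_derivative_compose, OF H, THEN partial_eq, simplified]
  \<comment> \<open>A variation of \<open>p\<close> alone has zero base increment, so only the
    pairing with the velocity survives.\<close>
  have "G' (0, 0) = 0"
    using linear_0[OF has_derivative_linear[OF G'(1)]] by (simp add: zero_prod_def)
  with d(1) show ?p
    by (simp add: x_def inner_axis')
  from d(2) G'(2) show ?q
    by (simp add: x_def partial_eq)
qed

end

subsection \<open>Equivalence of the two systems\<close>

lemma chance_AE_mono:
  assumes "chance_AE Cr M R" "\<And>\<theta> \<omega>. R \<theta> \<omega> \<Longrightarrow> R' \<theta> \<omega>"
  shows "chance_AE Cr M R'"
  using assms unfolding chance_AE_def by (auto elim!: eventually_mono)

lemma chance_AE_conj_iff:
  "chance_AE Cr M (\<lambda>\<theta> \<omega>. R \<theta> \<omega> \<and> R' \<theta> \<omega>) \<longleftrightarrow> chance_AE Cr M R \<and> chance_AE Cr M R'"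
  unfolding chance_AE_def by auto

text \<open>The Ito and Liu integrals \<open>I\<close> and \<open>J\<close> serve again as
  witnesses, since only the drift changes. Outside one exceptional event, common to all
  \<open>s\<close>, the two drifts agree throughout \<open>{a..b}\<close>, so their path integrals
  agree.\<close>

lemma hybrid_equation_on_cong:
  assumes eq: "hybrid_equation_on Cr L M F W E y f g k a b"
    and f: "chance_AE Cr M (\<lambda>\<theta> \<omega>. \<omega> \<in> E \<theta> \<longrightarrow> (\<forall>s\<in>{a..b}. f s \<theta> \<omega> = f' s \<theta> \<omega>))"
  shows "hybrid_equation_on Cr L M F W E y f' g k a b"
proof -
  obtain I J where I: "\<And>\<theta>. Cr {\<theta>} > 0 \<Longrightarrow> ito_integral_on M F W (E \<theta>) (\<lambda>s. g s \<theta>) a b (I \<theta>)"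
    and J: "chance_AE Cr M (\<lambda>\<theta> \<omega>. \<omega> \<in> E \<theta> \<longrightarrow>
          liu_integral (\<lambda>s. L s \<theta>) (\<lambda>s. k s \<theta> \<omega>) a b (J \<theta> \<omega>) \<and>
          set_integrable lborel {a..b} (\<lambda>s. f s \<theta> \<omega>) \<and>
          y b \<theta> \<omega> - y a \<theta> \<omega> = (LBINT s:{a..b}. f s \<theta> \<omega>) + I \<theta> \<omega> + J \<theta> \<omega>)"
    using eq unfolding hybrid_equation_on_def by (elim exE conjE) blast
  have "chance_AE Cr M (\<lambda>\<theta> \<omega>. \<omega> \<in> E \<theta> \<longrightarrow>
          liu_integral (\<lambda>s. L s \<theta>) (\<lambda>s. k s \<theta> \<omega>) a b (J \<theta> \<omega>) \<and>
          set_integrable lborel {a..b} (\<lambda>s. f' s \<theta> \<omega>) \<and>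
          y b \<theta> \<omega> - y a \<theta> \<omega> = (LBINT s:{a..b}. f' s \<theta> \<omega>) + I \<theta> \<omega> + J \<theta> \<omega>)"
  proof (rule chance_AE_mono[OF chance_AE_conj_iff[THEN iffD2, OF conjI, OF J f]], safe)
    fix \<theta> \<omega> assume e: "\<forall>s\<in>{a..b}. f s \<theta> \<omega> = f' s \<theta> \<omega>"
    show "set_integrable lborel {a..b} (\<lambda>s. f' s \<theta> \<omega>)"
      if "set_integrable lborel {a..b} (\<lambda>s. f s \<theta> \<omega>)"
      using that e set_integrable_cong[of lborel lborel "{a..b}" "{a..b}" "\<lambda>s. f s \<theta> \<omega>" "\<lambda>s. f' s \<theta> \<omega>"]
      by simp
    show "y b \<theta> \<omega> - y a \<theta> \<omega> = (LBINT s:{a..b}. f' s \<theta> \<omega>) + I \<theta> \<omega> + J \<theta> \<omega>"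
      if "y b \<theta> \<omega> - y a \<theta> \<omega> = (LBINT s:{a..b}. f s \<theta> \<omega>) + I \<theta> \<omega> + J \<theta> \<omega>"
      using that e set_lebesgue_integral_cong[of "{a..b}" lborel "\<lambda>s. f s \<theta> \<omega>" "\<lambda>s. f' s \<theta> \<omega>"] by simp
  qed
  with I show ?thesis
    unfolding hybrid_equation_on_def by (intro exI[of _ I] exI[of _ J] conjI allI impI)
qed

lemma hybrid_system_cong:
  assumes sys: "hybrid_system A \<gamma>\<^sub>1 \<gamma>\<^sub>2 Cr L M F W S q p u f"
    and S: "is_interval S"
    and eq: "chance_AE Cr M (\<lambda>\<theta> \<omega>. \<forall>s\<in>S. \<forall>c\<in>A. q s \<theta> \<omega> \<in> chart_dom c \<longrightarrow>
      (\<forall>i. u i s \<theta> \<omega> c = u' i s \<theta> \<omega> c \<and> f i s \<theta> \<omega> c = f' i s \<theta> \<omega> c))"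
  shows "hybrid_system A \<gamma>\<^sub>1 \<gamma>\<^sub>2 Cr L M F W S q p u' f'"
proof -
  note sys' = sys[unfolded hybrid_system_def Let_def]
  note adapted = sys'[THEN conjunct1]
    and path = sys'[THEN conjunct2, THEN conjunct1]
    and equations = sys'[THEN conjunct2, THEN conjunct2, THEN bspec, THEN bspec, THEN bspec, THEN mp, THEN spec]
  show ?thesis
    unfolding hybrid_system_def Let_def
  proof (rule conjI[OF adapted conjI[OF path]], intro ballI impI allI conjI)
    fix c a b i assume c: "c \<in> A" and ab: "a \<in> S" "b \<in> S" "a \<le> b"
    let ?E = "\<lambda>\<theta>. {\<omega>. \<forall>s\<in>{a..b}. q s \<theta> \<omega> \<in> chart_dom c}"
    let ?x = "\<lambda>s \<theta> \<omega>. chart_coord c (q s \<theta> \<omega>)"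
    \<comment> \<open>An interval contains everything between two of its points, so agreement of the
      drifts on \<open>S\<close> covers all of \<open>{a..b}\<close>.\<close>
    have abS: "{a..b} \<subseteq> S"
      using mem_is_interval_1_I[OF S ab(1,2)] by auto
    have eq': "chance_AE Cr M (\<lambda>\<theta> \<omega>. \<omega> \<in> ?E \<theta> \<longrightarrow>
        (\<forall>s\<in>{a..b}. u i s \<theta> \<omega> c = u' i s \<theta> \<omega> c \<and> f i s \<theta> \<omega> c = f' i s \<theta> \<omega> c))"
      by (rule chance_AE_mono[OF eq]) (use c abS in blast)
    have u: "chance_AE Cr M (\<lambda>\<theta> \<omega>. \<omega> \<in> ?E \<theta> \<longrightarrow>
        set_integrable lborel {a..b} (\<lambda>s. u i s \<theta> \<omega> c) \<and>
        ?x b \<theta> \<omega> $ i - ?x a \<theta> \<omega> $ i = (LBINT s:{a..b}. u i s \<theta> \<omega> c))"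
      and f: "hybrid_equation_on Cr L M F W ?E (\<lambda>s \<theta> \<omega>. p s \<theta> \<omega> c $ i) (\<lambda>s \<theta> \<omega>. f i s \<theta> \<omega> c)
        (\<lambda>s \<theta> \<omega>. partial i (\<gamma>\<^sub>1 \<circ> chart_inv c) (?x s \<theta> \<omega>))
        (\<lambda>s \<theta> \<omega>. partial i (\<gamma>\<^sub>2 \<circ> chart_inv c) (?x s \<theta> \<omega>)) a b"
      by (rule conjunct1[OF equations[OF c ab, of i]], rule conjunct2[OF equations[OF c ab, of i]])
    show "chance_AE Cr M (\<lambda>\<theta> \<omega>. \<omega> \<in> ?E \<theta> \<longrightarrow>
        set_integrable lborel {a..b} (\<lambda>s. u' i s \<theta> \<omega> c) \<and>
        ?x b \<theta> \<omega> $ i - ?x a \<theta> \<omega> $ i = (LBINT s:{a..b}. u' i s \<theta> \<omega> c))"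
    proof (rule chance_AE_mono[OF chance_AE_conj_iff[THEN iffD2, OF conjI, OF u eq']], intro impI)
      fix \<theta> \<omega>
      let ?u = "\<lambda>s. u i s \<theta> \<omega> c" and ?u' = "\<lambda>s. u' i s \<theta> \<omega> c"
      assume "\<omega> \<in> ?E \<theta>" and *: "(\<omega> \<in> ?E \<theta> \<longrightarrow> set_integrable lborel {a..b} ?u \<and>
          ?x b \<theta> \<omega> $ i - ?x a \<theta> \<omega> $ i = (LBINT s:{a..b}. ?u s)) \<and>
        (\<omega> \<in> ?E \<theta> \<longrightarrow> (\<forall>s\<in>{a..b}. ?u s = ?u' s \<and> f i s \<theta> \<omega> c = f' i s \<theta> \<omega> c))"
      have e: "?u s = ?u' s" if "s \<in> {a..b}" for s
        using *[THEN conjunct2, THEN mp, OF \<open>\<omega> \<in> ?E \<theta>\<close>] that by blast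
      have "set_integrable lborel {a..b} ?u = set_integrable lborel {a..b} ?u'"
        using e by (intro set_integrable_cong) auto
      moreover have "(LBINT s:{a..b}. ?u s) = (LBINT s:{a..b}. ?u' s)"
        using e by (intro set_lebesgue_integral_cong) auto
      ultimately show "set_integrable lborel {a..b} ?u' \<and>
          ?x b \<theta> \<omega> $ i - ?x a \<theta> \<omega> $ i = (LBINT s:{a..b}. ?u' s)"
        using *[THEN conjunct1, THEN mp, OF \<open>\<omega> \<in> ?E \<theta>\<close>] by (simp only:)
    qed
    show "hybrid_equation_on Cr L M F W ?E (\<lambda>s \<theta> \<omega>. p s \<theta> \<omega> c $ i) (\<lambda>s \<theta> \<omega>. f' i s \<theta> \<omega> c)
        (\<lambda>s \<theta> \<omega>. partial i (\<gamma>\<^sub>1 \<circ> chart_inv c) (?x s \<theta> \<omega>))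
        (\<lambda>s \<theta> \<omega>. partial i (\<gamma>\<^sub>2 \<circ> chart_inv c) (?x s \<theta> \<omega>)) a b"
      by (rule hybrid_equation_on_cong[OF f]) (rule chance_AE_mono[OF eq'], blast)
  qed
qed

lemma hybrid_system_cotangent:
  assumes "hybrid_system A \<gamma>\<^sub>1 \<gamma>\<^sub>2 Cr L M F W S q p u f"
  shows "chance_AE Cr M (\<lambda>\<theta> \<omega>. \<forall>s\<in>S. (q s \<theta> \<omega>, p s \<theta> \<omega>) \<in> cotangent_bundle A)"
  using assms unfolding hybrid_system_def chance_AE_conj_iff by blast

section \<open>Both kinds of solution as pairs related by the Legendre transformation\<close>

context lagrangian_atlas
begin

text \<open>In the charts around \<open>m\<close> this is a comparison of components; at all other
  arguments both covectors are zero, for \<open>P\<close> because it lies in the cotangent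
  bundle.\<close>

lemma legendre_eq_iff:
  assumes "(m, P) \<in> cotangent_bundle A"
  shows "legendre A \<L> t (m, X) = (m, P) \<longleftrightarrow>
    (\<forall>c\<in>A. m \<in> chart_dom c \<longrightarrow> (\<forall>i. P c $ i = partial i (G c (chart_coord c m)) (X c)))"
  using bundle_outside_chart[of m P] assms
  by (auto simp: legendre_def fun_eq_iff vec_eq_iff)

lemma legendre_component:
  assumes "legendre A \<L> t (m, X) = (m, P)" "c \<in> A" "m \<in> chart_dom c"
  shows "P c $ i = partial i (G c (chart_coord c m)) (X c)"
  using snd_legendre[OF assms(2,3), of X] assms(1) by (simp add: fibre_map_def)

text \<open>This form isolates the relation \<open>legendre (q, v) = (q, p)\<close> on
  \<open>D\<close>, shared with \<open>Hamilton_solution_iff\<close>, so that only the drifts remain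
  to be compared. The system places \<open>(q, p)\<close> in the cotangent bundle, which turns the
  momentum equations into that relation; conversely \<open>D\<close> lies in the tangent
  bundle.\<close>

lemma HP_solution_iff:
  assumes D: "legendre_domain A \<L> t D"
  shows "HP_solution A \<L> \<gamma>\<^sub>1 \<gamma>\<^sub>2 \<alpha> \<rho> Cr L M F W t S q v p \<and>
      chance_AE Cr M (\<lambda>\<theta> \<omega>. \<forall>s\<in>S. (q s \<theta> \<omega>, v s \<theta> \<omega>) \<in> D) \<longleftrightarrow>
    chance_AE Cr M (\<lambda>\<theta> \<omega>. \<forall>s\<in>S. (q s \<theta> \<omega>, v s \<theta> \<omega>) \<in> D \<and>
      legendre A \<L> t (q s \<theta> \<omega>, v s \<theta> \<omega>) = (q s \<theta> \<omega>, p s \<theta> \<omega>)) \<and>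
    hybrid_system A \<gamma>\<^sub>1 \<gamma>\<^sub>2 Cr L M F W S q p
       (\<lambda>i s \<theta> \<omega> c. v s \<theta> \<omega> c $ i)
       (\<lambda>i s \<theta> \<omega> c.
          partial i (\<lambda>x. lagr A \<L> c t x (v s \<theta> \<omega> c)) (chart_coord c (q s \<theta> \<omega>))
          - p s \<theta> \<omega> c $ i * frac_coeff \<alpha> \<rho> s t)" (is "?HP \<and> ?D \<longleftrightarrow> ?R \<and> ?sys")
proof
  assume HP: "?HP \<and> ?D"
  then have sys: ?sys
    unfolding HP_solution_def by blast
  have "chance_AE Cr M (\<lambda>\<theta> \<omega>. (\<forall>s\<in>S. \<forall>c\<in>A. q s \<theta> \<omega> \<in> chart_dom c \<longrightarrow>
      (\<forall>i. p s \<theta> \<omega> c $ i = partial i (G c (chart_coord c (q s \<theta> \<omega>))) (v s \<theta> \<omega> c))) \<and>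
      (\<forall>s\<in>S. (q s \<theta> \<omega>, v s \<theta> \<omega>) \<in> D) \<and> (\<forall>s\<in>S. (q s \<theta> \<omega>, p s \<theta> \<omega>) \<in> cotangent_bundle A))"
    unfolding chance_AE_conj_iff
    using HP hybrid_system_cotangent[OF sys] by (simp add: HP_solution_def)
  then have ?R
    by (rule chance_AE_mono) (simp add: legendre_eq_iff)
  then show "?R \<and> ?sys"
    using sys by (rule conjI)
next
  assume R: "?R \<and> ?sys"
  have "?D"
    by (rule chance_AE_mono[OF conjunct1[OF R]]) blast
  moreover have "chance_AE Cr M (\<lambda>\<theta> \<omega>. \<forall>s\<in>S. (q s \<theta> \<omega>, v s \<theta> \<omega>) \<in> tangent_bundle A)"
    by (rule chance_AE_mono[OF conjunct1[OF R]]) (use D in \<open>unfold legendre_domain_def, blast\<close>)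
  moreover have "chance_AE Cr M (\<lambda>\<theta> \<omega>. \<forall>s\<in>S. \<forall>c\<in>A. q s \<theta> \<omega> \<in> chart_dom c \<longrightarrow>
      (\<forall>i. p s \<theta> \<omega> c $ i = partial i (G c (chart_coord c (q s \<theta> \<omega>))) (v s \<theta> \<omega> c)))"
    by (rule chance_AE_mono[OF conjunct1[OF R]]) (blast intro: legendre_component)
  ultimately show "?HP \<and> ?D"
    using R unfolding HP_solution_def by blast
qed

text \<open>By injectivity on \<open>D\<close>, lying in the image with \<open>v\<close> given by
  \<open>legendre_inv\<close> means the same as lying in \<open>D\<close> and being sent to
  \<open>(q, p)\<close>.\<close>

lemma Hamilton_solution_iff:
  assumes D: "legendre_domain A \<L> t D"
  shows "Hamilton_solution A \<L> \<gamma>\<^sub>1 \<gamma>\<^sub>2 \<alpha> \<rho> Cr L M F W t S D q p \<and>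
      chance_AE Cr M (\<lambda>\<theta> \<omega>. \<forall>s\<in>S.
        (q s \<theta> \<omega>, v s \<theta> \<omega>) = legendre_inv A \<L> t D (q s \<theta> \<omega>, p s \<theta> \<omega>)) \<longleftrightarrow>
    chance_AE Cr M (\<lambda>\<theta> \<omega>. \<forall>s\<in>S. (q s \<theta> \<omega>, v s \<theta> \<omega>) \<in> D \<and>
      legendre A \<L> t (q s \<theta> \<omega>, v s \<theta> \<omega>) = (q s \<theta> \<omega>, p s \<theta> \<omega>)) \<and>
    hybrid_system A \<gamma>\<^sub>1 \<gamma>\<^sub>2 Cr L M F W S q p
       (\<lambda>i s \<theta> \<omega> c.
          partial i (hamiltonian A \<L> t D c (chart_coord c (q s \<theta> \<omega>))) (p s \<theta> \<omega> c))
       (\<lambda>i s \<theta> \<omega> c.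
          - partial i (\<lambda>x. hamiltonian A \<L> t D c x (p s \<theta> \<omega> c)) (chart_coord c (q s \<theta> \<omega>))
          - p s \<theta> \<omega> c $ i * frac_coeff \<alpha> \<rho> s t)"
proof -
  have inj: "inj_on (legendre A \<L> t) D"
    using D by (simp add: legendre_domain_def)
  have "y \<in> legendre A \<L> t ` D \<and> z = legendre_inv A \<L> t D y \<longleftrightarrow> z \<in> D \<and> legendre A \<L> t z = y" for y z
    using inj by (auto simp: inv_into_f_f)
  then have "(\<forall>s\<in>S. (q s \<theta> \<omega>, p s \<theta> \<omega>) \<in> legendre A \<L> t ` D) \<and>
      (\<forall>s\<in>S. (q s \<theta> \<omega>, v s \<theta> \<omega>) = legendre_inv A \<L> t D (q s \<theta> \<omega>, p s \<theta> \<omega>)) \<longleftrightarrow>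
    (\<forall>s\<in>S. (q s \<theta> \<omega>, v s \<theta> \<omega>) \<in> D \<and>
      legendre A \<L> t (q s \<theta> \<omega>, v s \<theta> \<omega>) = (q s \<theta> \<omega>, p s \<theta> \<omega>))" for \<theta> \<omega>
    by blast
  then show ?thesis
    unfolding Hamilton_solution_def
    using chance_AE_conj_iff[of Cr M "\<lambda>\<theta> \<omega>. \<forall>s\<in>S. (q s \<theta> \<omega>, p s \<theta> \<omega>) \<in> legendre A \<L> t ` D"
        "\<lambda>\<theta> \<omega>. \<forall>s\<in>S. (q s \<theta> \<omega>, v s \<theta> \<omega>) = legendre_inv A \<L> t D (q s \<theta> \<omega>, p s \<theta> \<omega>)"]
    by auto
qed

text \<open>Once the Legendre relation is common to both sides, \<open>hamiltonian_partials\<close>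
  identifies the drifts at every time, and \<open>hybrid_system_cong\<close> exchanges them in
  either direction.\<close>

lemma HP_iff_Hamilton:
  assumes D: "legendre_domain A \<L> t D" and S: "is_interval S"
  shows "HP_solution A \<L> \<gamma>\<^sub>1 \<gamma>\<^sub>2 \<alpha> \<rho> Cr L M F W t S q v p \<and>
      chance_AE Cr M (\<lambda>\<theta> \<omega>. \<forall>s\<in>S. (q s \<theta> \<omega>, v s \<theta> \<omega>) \<in> D) \<longleftrightarrow>
    Hamilton_solution A \<L> \<gamma>\<^sub>1 \<gamma>\<^sub>2 \<alpha> \<rho> Cr L M F W t S D q p \<and>
      chance_AE Cr M (\<lambda>\<theta> \<omega>. \<forall>s\<in>S.
        (q s \<theta> \<omega>, v s \<theta> \<omega>) = legendre_inv A \<L> t D (q s \<theta> \<omega>, p s \<theta> \<omega>))"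
  unfolding HP_solution_iff[OF D] Hamilton_solution_iff[OF D]
proof (intro conj_cong refl iffI)
  \<comment> \<open>The rule \<open>conj_cong\<close> supplies the shared first conjunct as a
    hypothesis for comparing the two systems.\<close>
  assume R: "chance_AE Cr M (\<lambda>\<theta> \<omega>. \<forall>s\<in>S. (q s \<theta> \<omega>, v s \<theta> \<omega>) \<in> D \<and>
    legendre A \<L> t (q s \<theta> \<omega>, v s \<theta> \<omega>) = (q s \<theta> \<omega>, p s \<theta> \<omega>))"
  have partials: "partial i (hamiltonian A \<L> t D c (chart_coord c (q s \<theta> \<omega>))) (p s \<theta> \<omega> c) = v s \<theta> \<omega> c $ i"
      "partial i (\<lambda>x. hamiltonian A \<L> t D c x (p s \<theta> \<omega> c)) (chart_coord c (q s \<theta> \<omega>)) =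
        - partial i (\<lambda>x. G c x (v s \<theta> \<omega> c)) (chart_coord c (q s \<theta> \<omega>))"
    if "\<forall>s\<in>S. (q s \<theta> \<omega>, v s \<theta> \<omega>) \<in> D \<and>
        legendre A \<L> t (q s \<theta> \<omega>, v s \<theta> \<omega>) = (q s \<theta> \<omega>, p s \<theta> \<omega>)"
      "s \<in> S" "c \<in> A" "q s \<theta> \<omega> \<in> chart_dom c" for s \<theta> \<omega> c i
    using hamiltonian_partials[OF D _ _ that(3,4)] that(1,2) by blast+
  note cong = hybrid_system_cong[OF _ S chance_AE_mono[OF R]]
  show "hybrid_system A \<gamma>\<^sub>1 \<gamma>\<^sub>2 Cr L M F W S q p
      (\<lambda>i s \<theta> \<omega> c. partial i (hamiltonian A \<L> t D c (chart_coord c (q s \<theta> \<omega>))) (p s \<theta> \<omega> c))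
      (\<lambda>i s \<theta> \<omega> c.
         - partial i (\<lambda>x. hamiltonian A \<L> t D c x (p s \<theta> \<omega> c)) (chart_coord c (q s \<theta> \<omega>))
         - p s \<theta> \<omega> c $ i * frac_coeff \<alpha> \<rho> s t)"
    if "hybrid_system A \<gamma>\<^sub>1 \<gamma>\<^sub>2 Cr L M F W S q p (\<lambda>i s \<theta> \<omega> c. v s \<theta> \<omega> c $ i)
      (\<lambda>i s \<theta> \<omega> c. partial i (\<lambda>x. G c x (v s \<theta> \<omega> c)) (chart_coord c (q s \<theta> \<omega>))
         - p s \<theta> \<omega> c $ i * frac_coeff \<alpha> \<rho> s t)"
    using that by (rule cong) (simp add: partials)
  show "hybrid_system A \<gamma>\<^sub>1 \<gamma>\<^sub>2 Cr L M F W S q p (\<lambda>i s \<theta> \<omega> c. v s \<theta> \<omega> c $ i)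
      (\<lambda>i s \<theta> \<omega> c. partial i (\<lambda>x. G c x (v s \<theta> \<omega> c)) (chart_coord c (q s \<theta> \<omega>))
         - p s \<theta> \<omega> c $ i * frac_coeff \<alpha> \<rho> s t)"
    if "hybrid_system A \<gamma>\<^sub>1 \<gamma>\<^sub>2 Cr L M F W S q p
      (\<lambda>i s \<theta> \<omega> c. partial i (hamiltonian A \<L> t D c (chart_coord c (q s \<theta> \<omega>))) (p s \<theta> \<omega> c))
      (\<lambda>i s \<theta> \<omega> c.
         - partial i (\<lambda>x. hamiltonian A \<L> t D c x (p s \<theta> \<omega> c)) (chart_coord c (q s \<theta> \<omega>))
         - p s \<theta> \<omega> c $ i * frac_coeff \<alpha> \<rho> s t)"
    using that by (rule cong) (simp add: partials)
qed

end

text \<open>A non-vanishing Hessian inverts the fibre derivative only locally, so the equivalence is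
  stated for velocities in a Legendre domain \<open>D\<close>; the first conjunct shows that such
  domains cover the tangent bundle. The condition \<open>t \<notin> S\<close> renders
  \<open>s \<noteq> t\<close>, and \<open>S\<close> lies in \<open>{0..}\<close>, where the driving
  processes are specified.\<close>

theorem proposition2:
  fixes A :: "('q::t2_space, 'n::finite) chart set"
    and \<L> :: "('q, 'n) lagrangian"
    and \<gamma>\<^sub>1 \<gamma>\<^sub>2 :: "'q \<Rightarrow> real"
    and \<alpha> :: "real \<Rightarrow> real" and \<rho> e \<sigma> t :: real
    and Cr :: "'\<theta> set \<Rightarrow> real" and L :: "real \<Rightarrow> '\<theta> \<Rightarrow> real"
    and M :: "'\<omega> measure" and F :: "real \<Rightarrow> '\<omega> measure" and W :: "real \<Rightarrow> '\<omega> \<Rightarrow> real"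
    and S :: "real set"
  assumes "paracompact TYPE('q)" and "smooth_atlas A"
    and "regular_lagrangian A \<L>" and "hyperregular A \<L>"
    and "regular_potential A \<gamma>\<^sub>1" and "regular_potential A \<gamma>\<^sub>2"
    and "\<alpha> C1_differentiable_on UNIV" and "\<rho> > 0"
    and "wiener_process M F W"
    and "credibility Cr" and "\<sigma> > 0" and "liu_process Cr e \<sigma> L"
    and "is_interval S" and "S \<subseteq> {0..}" and "t \<notin> S"
  shows "(\<forall>z\<in>tangent_bundle A. \<exists>D. legendre_domain A \<L> t D \<and> z \<in> D) \<and>
    (\<forall>D. legendre_domain A \<L> t D \<longrightarrow>
      (\<forall>(q :: real \<Rightarrow> '\<theta> \<Rightarrow> '\<omega> \<Rightarrow> 'q) v p.
         HP_solution A \<L> \<gamma>\<^sub>1 \<gamma>\<^sub>2 \<alpha> \<rho> Cr L M F W t S q v p \<and>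
         chance_AE Cr M (\<lambda>\<theta> \<omega>. \<forall>s\<in>S. (q s \<theta> \<omega>, v s \<theta> \<omega>) \<in> D)
         \<longleftrightarrow>
         Hamilton_solution A \<L> \<gamma>\<^sub>1 \<gamma>\<^sub>2 \<alpha> \<rho> Cr L M F W t S D q p \<and>
         chance_AE Cr M (\<lambda>\<theta> \<omega>. \<forall>s\<in>S.
           (q s \<theta> \<omega>, v s \<theta> \<omega>) = legendre_inv A \<L> t D (q s \<theta> \<omega>, p s \<theta> \<omega>))))"
proof -
  interpret lagrangian_atlas A \<L> t
    using assms(2-4) by unfold_locales
  show ?thesis
    by (intro conjI ballI allI impI legendre_domain_exists HP_iff_Hamilton) (use assms(13) in auto)
qed

end
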